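(* The category $\mathbf{ZComp}$ of zero-dimensional Hausdorff compactifications and the category $\mathbf{zMaps}$ of Boolean z-maps are dually equivalent.
   Context: Boolean algebras with $0=1$ are allowed. A Hausdorff compactification is a map $c:X\to Y$ which is a dense embedding of a space $X$ into a compact Hausdorff space $Y$. $\mathbf{Comp}$ is the category whose objects are all Hausdorff compactifications $c:X\to Y$ and whose morphisms from $c:X\to Y$ to $c':X'\to Y'$ are all pairs $(f,g)$ of continuous maps $f:X\to X'$, $g:Y\to Y'$ with $g\circ c=c'\circ f$; composition is componentwise and identities are $(id_X,id_Y)$. $\mathbf{ZComp}$ is the full subcategory of $\mathbf{Comp}$ whose objects are those $c:X\to Y$ for which $Y$ is zero-dimensional (has a base of clopen sets). For a Boolean algebra $A$ and a complete atomic Boolean algebra $B$, a Boolean monomorphism $\alpha:A\to B$ is a Boolean z-map if every atom of $B$ is a meet of some elements of $\alpha(A)$. $\mathbf{zMaps}$ is the category whose objects are all Boolean z-maps and whose morphisms from $\alpha:A\to B$ to $\alpha':A'\to B'$ are all pairs $(\varphi,\sigma)$ with $\varphi:A\to A'$ a Boolean homomorphism, $\sigma:B\to B'$ a complete Boolean homomorphism and $\alpha'\circ\varphi=\sigma\circ\alpha$; composition is componentwise and identities are $(id_A,id_B)$. Two categories are dually equivalent if there are contravariant functors between them in both directions whose two composites are naturally isomorphic to the identity functors. *)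

theory Defs
  imports "HOL-Analysis.Analysis" "HOL-Algebra.Complete_Lattice"
begin

section \<open>Categories, contravariant functors, dual equivalence\<close>

text \<open>
  Hom-sets of different pairs of objects need not be disjoint; hence composition and the arrow
  part of a functor also receive the objects involved. In \<open>compn C a b c g f\<close> the arrow \<open>f\<close> goes
  from \<open>a\<close> to \<open>b\<close> and \<open>g\<close> from \<open>b\<close> to \<open>c\<close>.
\<close>

record ('o, 'm) cat =
  objs :: "'o set"
  homs :: "'o \<Rightarrow> 'o \<Rightarrow> 'm set"
  ident :: "'o \<Rightarrow> 'm"
  compn :: "'o \<Rightarrow> 'o \<Rightarrow> 'o \<Rightarrow> 'm \<Rightarrow> 'm \<Rightarrow> 'm"

definition category :: "('o, 'm) cat \<Rightarrow> bool" where
  "category C \<longleftrightarrow>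
     (\<forall>a\<in>objs C. ident C a \<in> homs C a a) \<and>
     (\<forall>a\<in>objs C. \<forall>b\<in>objs C. \<forall>c\<in>objs C. \<forall>f\<in>homs C a b. \<forall>g\<in>homs C b c.
        compn C a b c g f \<in> homs C a c) \<and>
     (\<forall>a\<in>objs C. \<forall>b\<in>objs C. \<forall>f\<in>homs C a b.
        compn C a a b f (ident C a) = f \<and> compn C a b b (ident C b) f = f) \<and>
     (\<forall>a\<in>objs C. \<forall>b\<in>objs C. \<forall>c\<in>objs C. \<forall>d\<in>objs C.
        \<forall>f\<in>homs C a b. \<forall>g\<in>homs C b c. \<forall>h\<in>homs C c d.
        compn C a b d (compn C b c d h g) f = compn C a c d h (compn C a b c g f))"

definition full_subcategory :: "('o, 'm) cat \<Rightarrow> ('o \<Rightarrow> bool) \<Rightarrow> ('o, 'm) cat" where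
  "full_subcategory C P = C\<lparr>objs := {a \<in> objs C. P a}\<rparr>"

definition is_iso :: "('o, 'm) cat \<Rightarrow> 'o \<Rightarrow> 'o \<Rightarrow> 'm \<Rightarrow> bool" where
  "is_iso C a b f \<longleftrightarrow> f \<in> homs C a b \<and>
     (\<exists>g\<in>homs C b a. compn C a b a g f = ident C a \<and> compn C b a b f g = ident C b)"

record ('o, 'm, 'p, 'n) fctr =
  fobj :: "'o \<Rightarrow> 'p"
  fmap :: "'o \<Rightarrow> 'o \<Rightarrow> 'm \<Rightarrow> 'n"

definition contravariant_functor ::
    "('o, 'm) cat \<Rightarrow> ('p, 'n) cat \<Rightarrow> ('o, 'm, 'p, 'n) fctr \<Rightarrow> bool" where
  "contravariant_functor C D F \<longleftrightarrow>
     (\<forall>a\<in>objs C. fobj F a \<in> objs D) \<and>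
     (\<forall>a\<in>objs C. \<forall>b\<in>objs C. \<forall>f\<in>homs C a b.
        fmap F a b f \<in> homs D (fobj F b) (fobj F a)) \<and>
     (\<forall>a\<in>objs C. fmap F a a (ident C a) = ident D (fobj F a)) \<and>
     (\<forall>a\<in>objs C. \<forall>b\<in>objs C. \<forall>c\<in>objs C. \<forall>f\<in>homs C a b. \<forall>g\<in>homs C b c.
        fmap F a c (compn C a b c g f) =
        compn D (fobj F c) (fobj F b) (fobj F a) (fmap F a b f) (fmap F b c g))"

definition identity_functor :: "('o, 'm, 'o, 'm) fctr" where
  "identity_functor = \<lparr>fobj = (\<lambda>a. a), fmap = (\<lambda>a b f. f)\<rparr>"

definition comp_contravariant ::
    "('p, 'n, 'q, 'k) fctr \<Rightarrow> ('o, 'm, 'p, 'n) fctr \<Rightarrow> ('o, 'm, 'q, 'k) fctr" where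
  "comp_contravariant G F =
     \<lparr>fobj = (\<lambda>a. fobj G (fobj F a)),
      fmap = (\<lambda>a b f. fmap G (fobj F b) (fobj F a) (fmap F a b f))\<rparr>"

text \<open>Natural isomorphism of covariant functors.\<close>

definition naturally_isomorphic ::
    "('o, 'm) cat \<Rightarrow> ('p, 'n) cat \<Rightarrow> ('o, 'm, 'p, 'n) fctr \<Rightarrow> ('o, 'm, 'p, 'n) fctr \<Rightarrow> bool" where
  "naturally_isomorphic C D F G \<longleftrightarrow>
     (\<exists>\<eta>. (\<forall>a\<in>objs C. is_iso D (fobj F a) (fobj G a) (\<eta> a)) \<and>
          (\<forall>a\<in>objs C. \<forall>b\<in>objs C. \<forall>f\<in>homs C a b.
             compn D (fobj F a) (fobj F b) (fobj G b) (\<eta> b) (fmap F a b f) =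
             compn D (fobj F a) (fobj G a) (fobj G b) (fmap G a b f) (\<eta> a)))"

definition dually_equivalent :: "('o, 'm) cat \<Rightarrow> ('p, 'n) cat \<Rightarrow> bool" where
  "dually_equivalent C D \<longleftrightarrow> category C \<and> category D \<and>
     (\<exists>(F :: ('o, 'm, 'p, 'n) fctr) (G :: ('p, 'n, 'o, 'm) fctr).
        contravariant_functor C D F \<and> contravariant_functor D C G \<and>
        naturally_isomorphic C C (comp_contravariant G F) identity_functor \<and>
        naturally_isomorphic D D (comp_contravariant F G) identity_functor)"

section \<open>Universes of small sets\<close>

text \<open>
  The objects of the categories below have underlying sets in a fixed collection \<open>\<U>\<close> of ``small''
  sets over a type \<open>'u\<close>, closed (up to bijection) under subsets and power sets. Examples: the small
  sets of a type of all ZFC sets, where one obtains the categories of all compactifications and of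
  all Boolean z-maps; or all sets of cardinality less than that of \<open>'u\<close>, whenever the latter
  is a strong limit cardinal. No further property of a Grothendieck universe is assumed.
\<close>

definition universe :: "'u set set \<Rightarrow> bool" where
  "universe \<U> \<longleftrightarrow>
     (\<forall>S\<in>\<U>. \<forall>T :: 'u set. T \<lesssim> S \<longrightarrow> T \<in> \<U>) \<and>
     (\<forall>S\<in>\<U>. \<exists>T\<in>\<U>. Pow S \<lesssim> T)"

section \<open>Hausdorff compactifications\<close>

definition zero_dimensional_space :: "'a topology \<Rightarrow> bool" where
  "zero_dimensional_space Y \<longleftrightarrow>
     (\<exists>\<B>. (\<forall>U\<in>\<B>. openin Y U \<and> closedin Y U) \<and>
          openin Y = arbitrary union_of (\<lambda>U. U \<in> \<B>))"

definition hausdorff_compactification ::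
    "'x topology \<Rightarrow> 'y topology \<Rightarrow> ('x \<Rightarrow> 'y) \<Rightarrow> bool" where
  "hausdorff_compactification X Y c \<longleftrightarrow>
     compact_space Y \<and> Hausdorff_space Y \<and>
     embedding_map X Y c \<and> Y closure_of (c ` topspace X) = topspace Y"

text \<open>
  All maps between carriers are taken extensional, so that equality of arrows is equality on the
  domain.
\<close>

record 'u top_map =
  src :: "'u topology"
  tgt :: "'u topology"
  cmap :: "'u \<Rightarrow> 'u"

definition Comp_cat :: "'u set set \<Rightarrow> ('u top_map, ('u \<Rightarrow> 'u) \<times> ('u \<Rightarrow> 'u)) cat" where
  "Comp_cat \<U> =
     \<lparr>objs = {K. topspace (src K) \<in> \<U> \<and> topspace (tgt K) \<in> \<U> \<and>
                 cmap K \<in> extensional (topspace (src K)) \<and>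
                 hausdorff_compactification (src K) (tgt K) (cmap K)},
      homs = (\<lambda>K K'. {(f, g).
                 f \<in> extensional (topspace (src K)) \<and> continuous_map (src K) (src K') f \<and>
                 g \<in> extensional (topspace (tgt K)) \<and> continuous_map (tgt K) (tgt K') g \<and>
                 (\<forall>x\<in>topspace (src K). g (cmap K x) = cmap K' (f x))}),
      ident = (\<lambda>K. (\<lambda>x\<in>topspace (src K). x, \<lambda>y\<in>topspace (tgt K). y)),
      compn = (\<lambda>K K' K'' (f', g') (f, g).
                 (compose (topspace (src K)) f' f, compose (topspace (tgt K)) g' g))\<rparr>"

definition ZComp_cat :: "'u set set \<Rightarrow> ('u top_map, ('u \<Rightarrow> 'u) \<times> ('u \<Rightarrow> 'u)) cat" where
  "ZComp_cat \<U> = full_subcategory (Comp_cat \<U>) (\<lambda>K. zero_dimensional_space (tgt K))"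

section \<open>Boolean z-maps\<close>

text \<open>The one-element algebra, where bottom and top coincide, is a \<open>boolean_alg\<close>.\<close>

locale boolean_alg = bounded_lattice L for L (structure) +
  assumes meet_join_distrib:
    "\<lbrakk>x \<in> carrier L; y \<in> carrier L; z \<in> carrier L\<rbrakk>
       \<Longrightarrow> x \<sqinter> (y \<squnion> z) = (x \<sqinter> y) \<squnion> (x \<sqinter> z)"
  and complement_exists:
    "x \<in> carrier L \<Longrightarrow> \<exists>y\<in>carrier L. x \<sqinter> y = \<bottom> \<and> x \<squnion> y = \<top>"

definition is_atom :: "('a, 'c) gorder_scheme \<Rightarrow> 'a \<Rightarrow> bool" where
  "is_atom L a \<longleftrightarrow> a \<in> carrier L \<and> a \<noteq> \<bottom>\<^bsub>L\<^esub> \<and>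
     (\<forall>x\<in>carrier L. x \<sqsubseteq>\<^bsub>L\<^esub> a \<longrightarrow> x = \<bottom>\<^bsub>L\<^esub> \<or> x = a)"

definition complete_atomic_boolean_alg :: "('a, 'c) gorder_scheme \<Rightarrow> bool" where
  "complete_atomic_boolean_alg L \<longleftrightarrow> boolean_alg L \<and> complete_lattice L \<and>
     (\<forall>x\<in>carrier L. x \<noteq> \<bottom>\<^bsub>L\<^esub> \<longrightarrow> (\<exists>a. is_atom L a \<and> a \<sqsubseteq>\<^bsub>L\<^esub> x))"

text \<open>Preservation of complements follows from the conditions below.\<close>

definition boolean_hom ::
    "('a, 'c) gorder_scheme \<Rightarrow> ('b, 'd) gorder_scheme \<Rightarrow> ('a \<Rightarrow> 'b) \<Rightarrow> bool" where
  "boolean_hom L M h \<longleftrightarrow>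
     h \<in> carrier L \<rightarrow> carrier M \<and>
     h \<bottom>\<^bsub>L\<^esub> = \<bottom>\<^bsub>M\<^esub> \<and> h \<top>\<^bsub>L\<^esub> = \<top>\<^bsub>M\<^esub> \<and>
     (\<forall>x\<in>carrier L. \<forall>y\<in>carrier L.
        h (x \<sqinter>\<^bsub>L\<^esub> y) = h x \<sqinter>\<^bsub>M\<^esub> h y \<and> h (x \<squnion>\<^bsub>L\<^esub> y) = h x \<squnion>\<^bsub>M\<^esub> h y)"

definition complete_boolean_hom ::
    "('a, 'c) gorder_scheme \<Rightarrow> ('b, 'd) gorder_scheme \<Rightarrow> ('a \<Rightarrow> 'b) \<Rightarrow> bool" where
  "complete_boolean_hom L M h \<longleftrightarrow> boolean_hom L M h \<and>
     (\<forall>S. S \<subseteq> carrier L \<longrightarrow>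
        h (\<Sqinter>\<^bsub>L\<^esub> S) = \<Sqinter>\<^bsub>M\<^esub> (h ` S) \<and> h (\<Squnion>\<^bsub>L\<^esub> S) = \<Squnion>\<^bsub>M\<^esub> (h ` S))"

definition boolean_z_map ::
    "('a, 'c) gorder_scheme \<Rightarrow> ('b, 'd) gorder_scheme \<Rightarrow> ('a \<Rightarrow> 'b) \<Rightarrow> bool" where
  "boolean_z_map A B \<alpha> \<longleftrightarrow>
     boolean_alg A \<and> complete_atomic_boolean_alg B \<and>
     boolean_hom A B \<alpha> \<and> inj_on \<alpha> (carrier A) \<and>
     (\<forall>x. is_atom B x \<longrightarrow> (\<exists>S. S \<subseteq> \<alpha> ` carrier A \<and> x = \<Sqinter>\<^bsub>B\<^esub> S))"

record 'u alg_map =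
  dalg :: "'u gorder"
  calg :: "'u gorder"
  amap :: "'u \<Rightarrow> 'u"

definition zMaps_cat :: "'u set set \<Rightarrow> ('u alg_map, ('u \<Rightarrow> 'u) \<times> ('u \<Rightarrow> 'u)) cat" where
  "zMaps_cat \<U> =
     \<lparr>objs = {Z. carrier (dalg Z) \<in> \<U> \<and> carrier (calg Z) \<in> \<U> \<and>
                 amap Z \<in> extensional (carrier (dalg Z)) \<and>
                 boolean_z_map (dalg Z) (calg Z) (amap Z)},
      homs = (\<lambda>Z Z'. {(\<phi>, \<sigma>).
                 \<phi> \<in> extensional (carrier (dalg Z)) \<and> boolean_hom (dalg Z) (dalg Z') \<phi> \<and>
                 \<sigma> \<in> extensional (carrier (calg Z)) \<and> complete_boolean_hom (calg Z) (calg Z') \<sigma> \<and>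
                 (\<forall>x\<in>carrier (dalg Z). amap Z' (\<phi> x) = \<sigma> (amap Z x))}),
      ident = (\<lambda>Z. (\<lambda>x\<in>carrier (dalg Z). x, \<lambda>y\<in>carrier (calg Z). y)),
      compn = (\<lambda>Z Z' Z'' (\<phi>', \<sigma>') (\<phi>, \<sigma>).
                 (compose (carrier (dalg Z)) \<phi>' \<phi>, compose (carrier (calg Z)) \<sigma>' \<sigma>))\<rparr>"

end

theory Submission
  imports Defs
begin

text \<open>
  A zero-dimensional compactification \<open>c : X \<rightarrow> Y\<close> is sent to the z-map \<open>V \<mapsto> c\<inverse>(V)\<close> from the clopen
  subsets of \<open>Y\<close> to all subsets of \<open>X\<close>: it is injective because \<open>c(X)\<close> is dense, and points of \<open>X\<close> are
  intersections of traces of clopen sets because these separate the points of \<open>Y\<close>. This contravariant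
  functor is fully faithful: a complete homomorphism between power sets is the preimage map of a unique
  map of points, and a homomorphism between clopen algebras yields, by compactness, a map of the
  spaces. It is essentially surjective: replacing \<open>B\<close> by the power set of its set \<open>X\<close> of atoms, a z-map
  \<open>\<alpha> : A \<rightarrow> B\<close> becomes the inclusion of a field of subsets of \<open>X\<close> that separates points, and the Stone
  space of this field is a compactification of \<open>X\<close>.
\<close>

section \<open>Equivalences from fully faithful functors\<close>

text \<open>Only one functor is written down. The inverse is chosen from full faithfulness and
  essential surjectivity, so Stone spaces enter through a single existence statement and need no
  functoriality of their own. The two components of an arrow are recovered independently of each
  other. What ties them together is separation by clopen sets: it turns the commuting square of
  homomorphisms into the commuting square of maps, and continuity on the dense part then follows
  because the target is embedded. On the algebraic side the same separation is exactly the condition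
  that atoms are meets of elements of the image. The remaining obstacle is type and size. Subsets
  have type \<open>'u set\<close>, whereas objects have their carriers inside \<open>'u\<close>; so
  subsets are coded by elements of \<open>'u\<close>, and the points of a Stone space, which are
  functions on a field of sets, are coded through subsets of the carrier of the given
  algebra.\<close>

lemma category_identI: "category C \<Longrightarrow> a \<in> objs C \<Longrightarrow> ident C a \<in> homs C a a"
  by (simp add: category_def)

lemma category_compn:
  "\<lbrakk>category C; a \<in> objs C; b \<in> objs C; c \<in> objs C; f \<in> homs C a b; g \<in> homs C b c\<rbrakk>
    \<Longrightarrow> compn C a b c g f \<in> homs C a c"
  by (simp add: category_def)

lemma category_compn_ident_right:
  "\<lbrakk>category C; a \<in> objs C; b \<in> objs C; f \<in> homs C a b\<rbrakk> \<Longrightarrow> compn C a a b f (ident C a) = f"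
  by (simp add: category_def)

lemma category_compn_ident_left:
  "\<lbrakk>category C; a \<in> objs C; b \<in> objs C; f \<in> homs C a b\<rbrakk> \<Longrightarrow> compn C a b b (ident C b) f = f"
  by (simp add: category_def)

lemma category_assoc:
  "\<lbrakk>category C; a \<in> objs C; b \<in> objs C; c \<in> objs C; d \<in> objs C;
    f \<in> homs C a b; g \<in> homs C b c; h \<in> homs C c d\<rbrakk>
    \<Longrightarrow> compn C a b d (compn C b c d h g) f = compn C a c d h (compn C a b c g f)"
  by (simp add: category_def)

lemma contravariant_functor_obj:
  "contravariant_functor C D F \<Longrightarrow> a \<in> objs C \<Longrightarrow> fobj F a \<in> objs D"
  by (simp add: contravariant_functor_def)

lemma contravariant_functor_map:
  "\<lbrakk>contravariant_functor C D F; a \<in> objs C; b \<in> objs C; f \<in> homs C a b\<rbrakk>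
    \<Longrightarrow> fmap F a b f \<in> homs D (fobj F b) (fobj F a)"
  by (simp add: contravariant_functor_def)

lemma contravariant_functor_ident:
  "\<lbrakk>contravariant_functor C D F; a \<in> objs C\<rbrakk> \<Longrightarrow> fmap F a a (ident C a) = ident D (fobj F a)"
  by (simp add: contravariant_functor_def)

lemma contravariant_functor_compn:
  "\<lbrakk>contravariant_functor C D F; a \<in> objs C; b \<in> objs C; c \<in> objs C;
    f \<in> homs C a b; g \<in> homs C b c\<rbrakk>
    \<Longrightarrow> fmap F a c (compn C a b c g f) =
        compn D (fobj F c) (fobj F b) (fobj F a) (fmap F a b f) (fmap F b c g)"
  by (simp add: contravariant_functor_def)

lemmas category_rules = category_identI category_compn

text \<open>For each \<open>d\<close> an object \<open>g d\<close> is chosen together with mutually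
  inverse arrows \<open>\<epsilon> d\<close> and \<open>\<delta> d\<close> between its image and
  \<open>d\<close>. Equations in \<open>C\<close> reduce by faithfulness to equations in
  \<open>D\<close>, and there arrows into \<open>H e\<close> are compared after composing with the
  invertible \<open>\<epsilon> e\<close>.\<close>

lemma dually_equivalent_if_fully_faithful:
  assumes C: "category C" and D: "category D" and F: "contravariant_functor C D F"
    and ff: "\<And>a b. a \<in> objs C \<Longrightarrow> b \<in> objs C \<Longrightarrow>
               bij_betw (fmap F a b) (homs C a b) (homs D (fobj F b) (fobj F a))"
    and ess: "\<And>d. d \<in> objs D \<Longrightarrow> \<exists>a\<in>objs C. \<exists>u. is_iso D (fobj F a) d u"
  shows "dually_equivalent C D"
proof -
  define iso_data where "iso_data d a u v \<longleftrightarrow> a \<in> objs C \<and>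
     u \<in> homs D (fobj F a) d \<and> v \<in> homs D d (fobj F a) \<and>
     compn D (fobj F a) d (fobj F a) v u = ident D (fobj F a) \<and>
     compn D d (fobj F a) d u v = ident D d" for d a u v
  have "\<forall>d\<in>objs D. \<exists>a u v. iso_data d a u v"
    using ess unfolding iso_data_def is_iso_def by blast
  then obtain g \<epsilon> \<delta> where iso: "\<forall>d\<in>objs D. iso_data d (g d) (\<epsilon> d) (\<delta> d)"
    by metis
  define H where "H d = fobj F (g d)" for d
  have g: "g d \<in> objs C" and H: "H d \<in> objs D"
    and \<epsilon>: "\<epsilon> d \<in> homs D (H d) d" and \<delta>: "\<delta> d \<in> homs D d (H d)"
    and \<delta>\<epsilon>: "compn D (H d) d (H d) (\<delta> d) (\<epsilon> d) = ident D (H d)"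
    and \<epsilon>\<delta>: "compn D d (H d) d (\<epsilon> d) (\<delta> d) = ident D d" if "d \<in> objs D" for d
    using iso that contravariant_functor_obj[OF F, of "g d"]
    unfolding iso_data_def H_def by auto
  define pre where "pre a b = inv_into (homs C a b) (fmap F a b)" for a b
  have pre: "pre a b u \<in> homs C a b" and F_pre: "fmap F a b (pre a b u) = u"
    if "a \<in> objs C" "b \<in> objs C" "u \<in> homs D (fobj F b) (fobj F a)" for a b u
    using ff[OF that(1,2)] that(3) unfolding pre_def bij_betw_def
    by (auto intro: inv_into_into f_inv_into_f)
  have pre_F: "pre a b (fmap F a b f) = f"
    if "a \<in> objs C" "b \<in> objs C" "f \<in> homs C a b" for a b f
    using ff[OF that(1,2)] that(3) unfolding pre_def bij_betw_def by auto
  have F_inj: "f = f'" if "a \<in> objs C" "b \<in> objs C" "f \<in> homs C a b" "f' \<in> homs C a b"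
    "fmap F a b f = fmap F a b f'" for a b f f'
    using pre_F that by metis
  \<comment> \<open>This is \<open>u\<close> conjugated by the chosen isomorphisms. It is covariant
    in \<open>D\<close>; the reversal of arrows comes only from pulling back along
    \<open>F\<close>.\<close>
  define K where "K d e u = compn D (H d) e (H e) (\<delta> e) (compn D (H d) d e u (\<epsilon> d))" for d e u
  have K: "K d e u \<in> homs D (H d) (H e)" if "d \<in> objs D" "e \<in> objs D" "u \<in> homs D d e" for d e u
    unfolding K_def by (intro category_rules[OF D] H \<epsilon> \<delta> that)
  \<comment> \<open>Naturality of \<open>\<epsilon>\<close> from \<open>K\<close> to the identity;
    it later supplies the naturality square for \<open>F\<close> after \<open>G\<close>.\<close>
  have \<epsilon>K: "compn D (H d) (H e) e (\<epsilon> e) (K d e u) = compn D (H d) d e u (\<epsilon> d)"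
    if "d \<in> objs D" "e \<in> objs D" "u \<in> homs D d e" for d e u
  proof -
    have uE: "compn D (H d) d e u (\<epsilon> d) \<in> homs D (H d) e"
      by (intro category_rules[OF D] H \<epsilon> that)
    have "compn D (H d) (H e) e (\<epsilon> e) (K d e u)
        = compn D (H d) e e (compn D e (H e) e (\<epsilon> e) (\<delta> e)) (compn D (H d) d e u (\<epsilon> d))"
      unfolding K_def by (rule category_assoc[OF D, symmetric]; intro H \<epsilon> \<delta> that uE)
    then show ?thesis
      using category_compn_ident_left[OF D _ _ uE] \<epsilon>\<delta> H that by simp
  qed
  \<comment> \<open>\<open>\<epsilon> e\<close> can be cancelled on the left, since
    \<open>\<delta> e\<close> splits it. Functoriality of \<open>K\<close> and naturality of
    \<open>\<delta>\<close> are thereby reduced to \<open>\<epsilon>K\<close>.\<close>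
  have \<delta>_cancel: "v = v'"
    if "d \<in> objs D" "e \<in> objs D" "v \<in> homs D d (H e)" "v' \<in> homs D d (H e)"
      "compn D d (H e) e (\<epsilon> e) v = compn D d (H e) e (\<epsilon> e) v'" for d e v v'
  proof -
    have *: "w = compn D d e (H e) (\<delta> e) (compn D d (H e) e (\<epsilon> e) w)" if "w \<in> homs D d (H e)" for w
    proof -
      have "compn D d (H e) (H e) (compn D (H e) e (H e) (\<delta> e) (\<epsilon> e)) w =
          compn D d e (H e) (\<delta> e) (compn D d (H e) e (\<epsilon> e) w)"
        by (rule category_assoc[OF D]; intro H \<epsilon> \<delta> that \<open>d \<in> objs D\<close> \<open>e \<in> objs D\<close>)
      then show ?thesis
        using category_compn_ident_left[OF D \<open>d \<in> objs D\<close> H[OF \<open>e \<in> objs D\<close>] that]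
          \<delta>\<epsilon>[OF \<open>e \<in> objs D\<close>] by simp
    qed
    from *[OF that(3)] *[OF that(4)] that(5) show ?thesis by simp
  qed
  have K_ident: "K d d (ident D d) = ident D (H d)" if d: "d \<in> objs D" for d
    unfolding K_def using category_compn_ident_left[OF D H[OF d] d \<epsilon>[OF d]] \<delta>\<epsilon>[OF d] by simp
  have K_compn: "K d e' (compn D d e e' v u) = compn D (H d) (H e) (H e') (K e e' v) (K d e u)"
    if obj: "d \<in> objs D" "e \<in> objs D" "e' \<in> objs D" and u: "u \<in> homs D d e" and v: "v \<in> homs D e e'"
    for d e e' u v
  proof (rule \<delta>_cancel[OF H[OF obj(1)] obj(3)])
    have vu: "compn D d e e' v u \<in> homs D d e'" by (intro category_rules[OF D] obj u v)
    note Ku = K[OF obj(1,2) u] and Kv = K[OF obj(2,3) v]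
    show "K d e' (compn D d e e' v u) \<in> homs D (H d) (H e')"
      "compn D (H d) (H e) (H e') (K e e' v) (K d e u) \<in> homs D (H d) (H e')"
      by (intro K category_rules[OF D] obj u v vu H)+
    have "compn D (H d) (H e') e' (\<epsilon> e') (K d e' (compn D d e e' v u))
        = compn D (H d) d e' (compn D d e e' v u) (\<epsilon> d)"
      by (intro \<epsilon>K obj vu)
    also have "\<dots> = compn D (H d) e e' v (compn D (H d) d e u (\<epsilon> d))"
      by (rule category_assoc[OF D]; intro obj H \<epsilon> u v)
    also have "\<dots> = compn D (H d) e e' v (compn D (H d) (H e) e (\<epsilon> e) (K d e u))"
      using \<epsilon>K[OF obj(1,2) u] by simp
    also have "\<dots> = compn D (H d) (H e) e' (compn D (H e) e e' v (\<epsilon> e)) (K d e u)"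
      by (rule category_assoc[OF D, symmetric]; intro obj H \<epsilon> v Ku)
    also have "\<dots> = compn D (H d) (H e) e' (compn D (H e) (H e') e' (\<epsilon> e') (K e e' v)) (K d e u)"
      using \<epsilon>K[OF obj(2,3) v] by simp
    also have "\<dots> = compn D (H d) (H e') e' (\<epsilon> e') (compn D (H d) (H e) (H e') (K e e' v) (K d e u))"
      by (rule category_assoc[OF D]; intro obj H \<epsilon> Kv Ku)
    finally show "compn D (H d) (H e') e' (\<epsilon> e') (K d e' (compn D d e e' v u)) =
      compn D (H d) (H e') e' (\<epsilon> e') (compn D (H d) (H e) (H e') (K e e' v) (K d e u))" .
  qed
  \<comment> \<open>\<open>K d e u\<close> runs from the image of \<open>g d\<close> to the image of
    \<open>g e\<close>, hence comes from an arrow \<open>g e\<close> to \<open>g d\<close>.\<close>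
  define G where "G = \<lparr>fobj = g, fmap = (\<lambda>d e u. pre (g e) (g d) (K d e u))\<rparr>"
  have FH: "fobj F (g d) = H d" for d by (simp add: H_def)
  have G_map: "pre (g e) (g d) (K d e u) \<in> homs C (g e) (g d)"
    and F_G: "fmap F (g e) (g d) (pre (g e) (g d) (K d e u)) = K d e u"
    if "d \<in> objs D" "e \<in> objs D" "u \<in> homs D d e" for d e u
    using pre[OF g g] F_pre[OF g g] K that by (simp_all add: FH)
  have contra_G: "contravariant_functor D C G"
    unfolding contravariant_functor_def G_def fctr.simps
  proof (intro conjI ballI)
    fix d assume d: "d \<in> objs D"
    show "g d \<in> objs C" using g d .
    show "pre (g d) (g d) (K d d (ident D d)) = ident C (g d)"
      using pre_F[OF g g category_identI[OF C g], OF d d d]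
        contravariant_functor_ident[OF F g[OF d]] K_ident[OF d] by (simp add: FH)
  next
    fix d e u assume "d \<in> objs D" "e \<in> objs D" "u \<in> homs D d e"
    then show "pre (g e) (g d) (K d e u) \<in> homs C (g e) (g d)" by (rule G_map)
  next
    fix d e e' u v assume obj: "d \<in> objs D" "e \<in> objs D" "e' \<in> objs D" and u: "u \<in> homs D d e" and v: "v \<in> homs D e e'"
    note vu = category_compn[OF D obj u v]
    note gs = g[OF obj(1)] g[OF obj(2)] g[OF obj(3)]
    note Gu = G_map[OF obj(1,2) u] and Gv = G_map[OF obj(2,3) v] and Gvu = G_map[OF obj(1,3) vu]
    show "pre (g e') (g d) (K d e' (compn D d e e' v u)) =
          compn C (g e') (g e) (g d) (pre (g e) (g d) (K d e u)) (pre (g e') (g e) (K e e' v))"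
      by (intro F_inj[OF gs(3,1) Gvu category_compn[OF C gs(3,2,1) Gv Gu]])
        (simp add: F_G obj u v vu contravariant_functor_compn[OF F gs(3,2,1) Gv Gu] FH,
          rule K_compn[OF obj u v])
  qed
  have iso_GF: "naturally_isomorphic C C (comp_contravariant G F) identity_functor"
    unfolding naturally_isomorphic_def comp_contravariant_def identity_functor_def fctr.simps
  \<comment> \<open>The component at \<open>a\<close> has to end in \<open>a\<close>. Since
    \<open>F\<close> reverses arrows, its image starts in \<open>fobj F a\<close>, so it is
    \<open>\<delta>\<close> and not \<open>\<epsilon>\<close> that is pulled back.\<close>
  proof (intro exI[of _ "\<lambda>a. pre (g (fobj F a)) a (\<delta> (fobj F a))"] conjI ballI)
    let ?\<eta> = "\<lambda>a. pre (g (fobj F a)) a (\<delta> (fobj F a))"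
    have Gobj: "fobj G d = g d" for d by (simp add: G_def)
    have \<eta>: "?\<eta> a \<in> homs C (g (fobj F a)) a" and F\<eta>: "fmap F (g (fobj F a)) a (?\<eta> a) = \<delta> (fobj F a)"
      if a: "a \<in> objs C" for a
      using pre[OF g a] F_pre[OF g a] \<delta> contravariant_functor_obj[OF F a] by (simp_all add: FH)
    fix a assume a: "a \<in> objs C"
    note Fa = contravariant_functor_obj[OF F a]
    note ga = g[OF Fa]
    let ?\<theta> = "pre a (g (fobj F a)) (\<epsilon> (fobj F a))"
    have \<theta>: "?\<theta> \<in> homs C a (g (fobj F a))" and F\<theta>: "fmap F a (g (fobj F a)) ?\<theta> = \<epsilon> (fobj F a)"
      using pre[OF a ga] F_pre[OF a ga] \<epsilon>[OF Fa] by (simp_all add: FH)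
    show "is_iso C (fobj G (fobj F a)) a (?\<eta> a)"
      unfolding is_iso_def Gobj
    proof (intro conjI bexI)
      show "compn C (g (fobj F a)) a (g (fobj F a)) ?\<theta> (?\<eta> a) = ident C (g (fobj F a))"
        by (rule F_inj[OF ga ga category_compn[OF C ga a ga \<eta>[OF a] \<theta>] category_identI[OF C ga]])
          (simp add: contravariant_functor_compn[OF F ga a ga \<eta>[OF a] \<theta>] F\<theta> F\<eta>[OF a]
             contravariant_functor_ident[OF F ga] FH \<delta>\<epsilon>[OF Fa])
      show "compn C a (g (fobj F a)) a (?\<eta> a) ?\<theta> = ident C a"
        by (rule F_inj[OF a a category_compn[OF C a ga a \<theta> \<eta>[OF a]] category_identI[OF C a]])
          (simp add: contravariant_functor_compn[OF F a ga a \<theta> \<eta>[OF a]] F\<theta> F\<eta>[OF a]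
             contravariant_functor_ident[OF F a] FH \<epsilon>\<delta>[OF Fa])
    qed (rule \<theta> \<eta>[OF a])+
    fix b f assume b: "b \<in> objs C" and f: "f \<in> homs C a b"
    note Fb = contravariant_functor_obj[OF F b] and Ff = contravariant_functor_map[OF F a b f]
    note gb = g[OF Fb]
    let ?GFf = "fmap G (fobj F b) (fobj F a) (fmap F a b f)"
    have GFf: "?GFf \<in> homs C (g (fobj F a)) (g (fobj F b))"
      and FGFf: "fmap F (g (fobj F a)) (g (fobj F b)) ?GFf = K (fobj F b) (fobj F a) (fmap F a b f)"
      using G_map[OF Fb Fa Ff] F_G[OF Fb Fa Ff] by (simp_all add: G_def)
    \<comment> \<open>The naturality square in \<open>C\<close> read through \<open>F\<close>: it
      becomes naturality of \<open>\<delta>\<close>, with the order of composition reversed.\<close>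
    have "compn D (fobj F b) (H (fobj F b)) (H (fobj F a)) (K (fobj F b) (fobj F a) (fmap F a b f)) (\<delta> (fobj F b))
        = compn D (fobj F b) (fobj F a) (H (fobj F a)) (\<delta> (fobj F a)) (fmap F a b f)"
    proof (rule \<delta>_cancel[OF Fb Fa])
      note HFa = H[OF Fa] and HFb = H[OF Fb] and KF = K[OF Fb Fa Ff]
      note facts = Fa Fb HFa HFb KF Ff \<epsilon>[OF Fa] \<epsilon>[OF Fb] \<delta>[OF Fa] \<delta>[OF Fb]
      show "compn D (fobj F b) (H (fobj F b)) (H (fobj F a)) (K (fobj F b) (fobj F a) (fmap F a b f)) (\<delta> (fobj F b))
          \<in> homs D (fobj F b) (H (fobj F a))"
        "compn D (fobj F b) (fobj F a) (H (fobj F a)) (\<delta> (fobj F a)) (fmap F a b f)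
          \<in> homs D (fobj F b) (H (fobj F a))"
        by (intro category_rules[OF D] facts)+
      let ?A = "fobj F a" and ?B = "fobj F b" and ?u = "fmap F a b f"
      have "compn D ?B (H ?A) ?A (\<epsilon> ?A) (compn D ?B (H ?B) (H ?A) (K ?B ?A ?u) (\<delta> ?B))
          = compn D ?B (H ?B) ?A (compn D (H ?B) (H ?A) ?A (\<epsilon> ?A) (K ?B ?A ?u)) (\<delta> ?B)"
        by (rule category_assoc[OF D, symmetric]; intro facts)
      also have "\<dots> = compn D ?B (H ?B) ?A (compn D (H ?B) ?B ?A ?u (\<epsilon> ?B)) (\<delta> ?B)"
        using \<epsilon>K[OF Fb Fa Ff] by simp
      also have "\<dots> = compn D ?B ?B ?A ?u (compn D ?B (H ?B) ?B (\<epsilon> ?B) (\<delta> ?B))"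
        by (rule category_assoc[OF D]; intro facts)
      also have "\<dots> = ?u"
        using \<epsilon>\<delta>[OF Fb] category_compn_ident_right[OF D Fb Fa Ff] by simp
      also have "\<dots> = compn D ?B ?A ?A (compn D ?A (H ?A) ?A (\<epsilon> ?A) (\<delta> ?A)) ?u"
        using \<epsilon>\<delta>[OF Fa] category_compn_ident_left[OF D Fb Fa Ff] by simp
      also have "\<dots> = compn D ?B (H ?A) ?A (\<epsilon> ?A) (compn D ?B ?A (H ?A) (\<delta> ?A) ?u)"
        by (rule category_assoc[OF D]; intro facts)
      finally show "compn D ?B (H ?A) ?A (\<epsilon> ?A) (compn D ?B (H ?B) (H ?A) (K ?B ?A ?u) (\<delta> ?B))
          = compn D ?B (H ?A) ?A (\<epsilon> ?A) (compn D ?B ?A (H ?A) (\<delta> ?A) ?u)" .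
    qed
    then show "compn C (fobj G (fobj F a)) (fobj G (fobj F b)) b (?\<eta> b) ?GFf =
        compn C (fobj G (fobj F a)) a b f (?\<eta> a)"
      unfolding Gobj
      by (intro F_inj[OF ga b category_compn[OF C ga gb b GFf \<eta>[OF b]] category_compn[OF C ga a b \<eta>[OF a] f]])
        (simp add: contravariant_functor_compn[OF F ga gb b GFf \<eta>[OF b]]
           contravariant_functor_compn[OF F ga a b \<eta>[OF a] f] FGFf F\<eta>[OF a] F\<eta>[OF b] FH)
  qed
  have iso_FG: "naturally_isomorphic D D (comp_contravariant F G) identity_functor"
    unfolding naturally_isomorphic_def comp_contravariant_def identity_functor_def fctr.simps
  proof (intro exI[of _ \<epsilon>] conjI ballI)
    fix d assume d: "d \<in> objs D"
    show "is_iso D (fobj F (fobj G d)) d (\<epsilon> d)"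
      unfolding is_iso_def G_def fctr.simps FH using \<epsilon> \<delta> \<epsilon>\<delta> \<delta>\<epsilon> d by blast
    fix e u assume e: "e \<in> objs D" and u: "u \<in> homs D d e"
    show "compn D (fobj F (fobj G d)) (fobj F (fobj G e)) e (\<epsilon> e)
            (fmap F (fobj G e) (fobj G d) (fmap G d e u)) =
          compn D (fobj F (fobj G d)) d e u (\<epsilon> d)"
      using F_G[OF d e u] \<epsilon>K[OF d e u] by (simp add: G_def FH)
  qed
  show ?thesis
    unfolding dually_equivalent_def using C D F contra_G iso_GF iso_FG by blast
qed

section \<open>Boolean algebras as fields of sets\<close>

text \<open>\<open>\<Sqinter>\<close> is defined by a \<open>SOME\<close>-choice, so it is computed
  by exhibiting a greatest lower bound and using uniqueness.\<close>

lemma (in partial_order) inf_eqI: "is_glb L w S \<Longrightarrow> \<Sqinter>\<^bsub>L\<^esub>S = w"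
  unfolding inf_def by (metis greatest_unique someI)

lemma (in partial_order) sup_eqI: "is_lub L w S \<Longrightarrow> \<Squnion>\<^bsub>L\<^esub>S = w"
  unfolding sup_def by (metis least_unique someI)

text \<open>\<open>r\<close> represents the order \<open>L\<close> as a field of sets; all Boolean algebra below is computed through
  such representations, so that homomorphisms become preimage maps.\<close>

locale set_rep = algebra X \<A> for X :: "'x set" and \<A> +
  fixes L :: "'a gorder" (structure) and r :: "'a \<Rightarrow> 'x set"
  assumes eq_eq: "eq L = (=)"
    and bij_r: "bij_betw r (carrier L) \<A>"
    and le_iff: "x \<in> carrier L \<Longrightarrow> y \<in> carrier L \<Longrightarrow> x \<sqsubseteq> y \<longleftrightarrow> r x \<subseteq> r y"
begin

lemma r_in: "x \<in> carrier L \<Longrightarrow> r x \<in> \<A>"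
  using bij_r by (auto simp: bij_betw_def)

lemma r_sub: "x \<in> carrier L \<Longrightarrow> r x \<subseteq> X"
  using r_in sets_into_space by blast

lemma r_surj: "U \<in> \<A> \<Longrightarrow> \<exists>x\<in>carrier L. r x = U"
  using bij_r by (auto simp: bij_betw_def)

lemma r_inj: "x \<in> carrier L \<Longrightarrow> y \<in> carrier L \<Longrightarrow> r x = r y \<Longrightarrow> x = y"
  using bij_r by (auto simp: bij_betw_def inj_on_def)

lemma partial_order: "partial_order L"
  by unfold_locales (auto simp: eq_eq le_iff intro: r_inj)

interpretation po: partial_order L
  by (rule partial_order)

text \<open>The factor \<open>X \<inter>\<close> makes the formula correct for empty
  \<open>S\<close>, whose intersection would otherwise be the whole type instead of the top element
  \<open>X\<close>.\<close>

lemma is_glbI: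
  assumes "S \<subseteq> carrier L" "w \<in> carrier L" "r w = X \<inter> \<Inter>(r ` S)"
  shows "is_glb L w S"
  using assms r_sub unfolding greatest_def Lower_def by (auto simp: le_iff subset_iff)

lemma is_lubI:
  assumes "S \<subseteq> carrier L" "w \<in> carrier L" "r w = \<Union>(r ` S)"
  shows "is_lub L w S"
  using assms unfolding least_def Upper_def by (auto simp: le_iff subset_iff)

lemma meet: assumes "x \<in> carrier L" "y \<in> carrier L"
  shows "is_glb L (x \<sqinter> y) {x, y}" "x \<sqinter> y \<in> carrier L" "r (x \<sqinter> y) = r x \<inter> r y"
proof -
  obtain w where w: "w \<in> carrier L" "r w = r x \<inter> r y"
    using r_surj[of "r x \<inter> r y"] r_in assms by blast
  have glb: "is_glb L w {x, y}"
    using w assms r_sub by (intro is_glbI) auto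
  then have "x \<sqinter> y = w"
    unfolding meet_def by (rule po.inf_eqI)
  with glb w show "is_glb L (x \<sqinter> y) {x, y}" "x \<sqinter> y \<in> carrier L" "r (x \<sqinter> y) = r x \<inter> r y" by auto
qed

lemma join: assumes "x \<in> carrier L" "y \<in> carrier L"
  shows "is_lub L (x \<squnion> y) {x, y}" "x \<squnion> y \<in> carrier L" "r (x \<squnion> y) = r x \<union> r y"
proof -
  obtain w where w: "w \<in> carrier L" "r w = r x \<union> r y"
    using r_surj[of "r x \<union> r y"] r_in assms by blast
  have lub: "is_lub L w {x, y}"
    using w assms by (intro is_lubI) auto
  then have "x \<squnion> y = w"
    unfolding join_def by (rule po.sup_eqI)
  with lub w show "is_lub L (x \<squnion> y) {x, y}" "x \<squnion> y \<in> carrier L" "r (x \<squnion> y) = r x \<union> r y" by auto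
qed

lemma bottom_exists: "\<exists>w. least L w (carrier L)"
proof -
  obtain w where "w \<in> carrier L" "r w = {}" using r_surj[of "{}"] by auto
  then show ?thesis by (intro exI[of _ w]) (auto simp: least_def le_iff)
qed

lemma top_exists: "\<exists>w. greatest L w (carrier L)"
proof -
  obtain w where "w \<in> carrier L" "r w = X" using r_surj[of X] by auto
  then show ?thesis using r_sub by (intro exI[of _ w]) (auto simp: greatest_def le_iff)
qed

lemma boolean_alg: "boolean_alg L"
proof -
  interpret bounded_lattice L
    by unfold_locales (use meet(1) join(1) bottom_exists top_exists in blast)+
  \<comment> \<open>The least element lies below the one that represents \<open>{}\<close>, so its
    own set is empty; dually for the top.\<close>
  have bot: "\<bottom> \<in> carrier L" "r \<bottom> = {}"
  proof -
    obtain w where "w \<in> carrier L" "r w = {}" using r_surj[of "{}"] by auto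
    then show "\<bottom> \<in> carrier L" "r \<bottom> = {}" using bottom_lower[of w] le_iff[of \<bottom> w] by auto
  qed
  have top: "\<top> \<in> carrier L" "r \<top> = X"
  proof -
    obtain w where "w \<in> carrier L" "r w = X" using r_surj[of X] by auto
    then show "\<top> \<in> carrier L" "r \<top> = X" using top_higher[of w] le_iff[of w \<top>] r_sub[of \<top>] by auto
  qed
  show ?thesis
  proof
    fix x y z assume "x \<in> carrier L" "y \<in> carrier L" "z \<in> carrier L"
    then show "x \<sqinter> (y \<squnion> z) = (x \<sqinter> y) \<squnion> (x \<sqinter> z)"
      by (intro r_inj) (auto simp: meet join)
  next
    fix x assume x: "x \<in> carrier L"
    then obtain y where y: "y \<in> carrier L" "r y = X - r x"
      using r_surj[of "X - r x"] r_in by blast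
    then show "\<exists>y\<in>carrier L. x \<sqinter> y = \<bottom> \<and> x \<squnion> y = \<top>"
      using x r_sub[OF x] bot top by (intro bexI[of _ y] conjI r_inj) (auto simp: meet join)
  qed
qed

interpretation boolean_alg L by (rule boolean_alg)

lemma bottom: "\<bottom> \<in> carrier L" "r \<bottom> = {}"
proof -
  obtain w where "w \<in> carrier L" "r w = {}" using r_surj[of "{}"] by auto
  then show "\<bottom> \<in> carrier L" "r \<bottom> = {}" using bottom_lower[of w] le_iff[of \<bottom> w] by auto
qed

lemma top: "\<top> \<in> carrier L" "r \<top> = X"
proof -
  obtain w where "w \<in> carrier L" "r w = X" using r_surj[of X] by auto
  then show "\<top> \<in> carrier L" "r \<top> = X" using top_higher[of w] le_iff[of w \<top>] r_sub[of \<top>] by auto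
qed

lemma compl: assumes x: "x \<in> carrier L"
  obtains y where "y \<in> carrier L" "r y = X - r x"
  using r_surj[of "X - r x"] r_in[OF x] by blast

end

text \<open>These are the complete atomic Boolean algebras: one direction is proved inside the
  locale, the other is \<open>atoms_pow_rep\<close>.\<close>

locale pow_rep = set_rep X "Pow X" L r for X :: "'x set" and L :: "'a gorder" (structure) and r
begin

interpretation po: partial_order L
  by (rule partial_order)

lemma Inf: assumes "S \<subseteq> carrier L"
  shows "is_glb L (\<Sqinter>S) S" "\<Sqinter>S \<in> carrier L" "r (\<Sqinter>S) = X \<inter> \<Inter>(r ` S)"
proof -
  obtain w where w: "w \<in> carrier L" "r w = X \<inter> \<Inter>(r ` S)"
    using r_surj[of "X \<inter> \<Inter>(r ` S)"] by blast
  have glb: "is_glb L w S" using w assms by (intro is_glbI)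
  then have "\<Sqinter>S = w" by (rule po.inf_eqI)
  with glb w show "is_glb L (\<Sqinter>S) S" "\<Sqinter>S \<in> carrier L" "r (\<Sqinter>S) = X \<inter> \<Inter>(r ` S)" by auto
qed

lemma Sup: assumes "S \<subseteq> carrier L"
  shows "is_lub L (\<Squnion>S) S" "\<Squnion>S \<in> carrier L" "r (\<Squnion>S) = \<Union>(r ` S)"
proof -
  have "\<Union>(r ` S) \<subseteq> X" using assms r_sub by blast
  then obtain w where w: "w \<in> carrier L" "r w = \<Union>(r ` S)"
    using r_surj[of "\<Union>(r ` S)"] by blast
  have lub: "is_lub L w S" using w assms by (intro is_lubI)
  then have "\<Squnion>S = w" by (rule po.sup_eqI)
  with lub w show "is_lub L (\<Squnion>S) S" "\<Squnion>S \<in> carrier L" "r (\<Squnion>S) = \<Union>(r ` S)" by auto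
qed

text \<open>The set of an atom contains some point, and the singleton of that point is represented
  too; minimality makes the two equal.\<close>

lemma atom_singleton: assumes "is_atom L a" shows "\<exists>p\<in>X. r a = {p}"
proof -
  have a: "a \<in> carrier L" "a \<noteq> \<bottom>" using assms by (auto simp: is_atom_def)
  then have "r a \<noteq> {}" using r_inj[of a \<bottom>] bottom by auto
  then obtain p where p: "p \<in> r a" by auto
  then have "p \<in> X" using r_sub a by blast
  then obtain b where b: "b \<in> carrier L" "r b = {p}" using r_surj[of "{p}"] by blast
  then have "b \<sqsubseteq> a" using p a by (simp add: le_iff)
  then have "b = a" using assms b bottom unfolding is_atom_def by blast
  then show ?thesis using b \<open>p \<in> X\<close> by auto
qed

lemma singleton_atom: assumes "a \<in> carrier L" "r a = {p}" shows "is_atom L a"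
  unfolding is_atom_def
proof (intro conjI ballI impI)
  show "a \<noteq> \<bottom>" using assms bottom by auto
  fix x assume "x \<in> carrier L" "x \<sqsubseteq> a"
  then have "r x = {} \<or> r x = {p}" using assms le_iff by auto
  then show "x = \<bottom> \<or> x = a" using assms bottom r_inj \<open>x \<in> carrier L\<close> by metis
qed (rule assms)

lemma complete_atomic_boolean_alg: "complete_atomic_boolean_alg L"
  unfolding complete_atomic_boolean_alg_def
proof (intro conjI ballI impI)
  show "boolean_alg L" by (rule boolean_alg)
  show "complete_lattice L" by unfold_locales (use Inf(1) Sup(1) in blast)+
  fix x assume x: "x \<in> carrier L" "x \<noteq> \<bottom>"
  then have "r x \<noteq> {}" using r_inj[of x \<bottom>] bottom by auto
  then obtain p where p: "p \<in> r x" by auto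
  then have "p \<in> X" using r_sub x by blast
  then obtain b where "b \<in> carrier L" "r b = {p}" using r_surj[of "{p}"] by blast
  then show "\<exists>a. is_atom L a \<and> a \<sqsubseteq> x"
    using singleton_atom[of b p] p x by (intro exI[of _ b]) (simp add: le_iff)
qed

end

section \<open>Homomorphisms induced by maps of points, and representations of given
  algebras\<close>

lemma pow_repI: "set_rep X (Pow X) L r \<Longrightarrow> pow_rep X L r"
  by (simp add: pow_rep_def)

text \<open>Preimages commute with finite set operations, and \<open>s\<close> is injective, so
  every equation can be checked on sets. That \<open>g\<close> takes \<open>Y\<close> into
  \<open>X\<close> is what sends the top to the top.\<close>

lemma boolean_hom_preimage:
  assumes L: "set_rep X \<A> L r" and M: "set_rep Y \<B> M s"
    and h: "h \<in> carrier L \<rightarrow> carrier M" and g: "g \<in> Y \<rightarrow> X"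
    and eq: "\<And>x. x \<in> carrier L \<Longrightarrow> s (h x) = g -` r x \<inter> Y"
  shows "boolean_hom L M h"
proof -
  interpret L: set_rep X \<A> L r by fact
  interpret M: set_rep Y \<B> M s by fact
  have hc: "h x \<in> carrier M" if "x \<in> carrier L" for x using h that by auto
  show ?thesis
    unfolding boolean_hom_def
  proof (intro conjI ballI)
    show "h \<bottom>\<^bsub>L\<^esub> = \<bottom>\<^bsub>M\<^esub>"
      by (rule M.r_inj) (auto simp: hc L.bottom M.bottom eq)
    show "h \<top>\<^bsub>L\<^esub> = \<top>\<^bsub>M\<^esub>"
      using g by (intro M.r_inj) (auto simp: hc L.top M.top eq)
    fix x y assume "x \<in> carrier L" "y \<in> carrier L"
    then show "h (x \<sqinter>\<^bsub>L\<^esub> y) = h x \<sqinter>\<^bsub>M\<^esub> h y" "h (x \<squnion>\<^bsub>L\<^esub> y) = h x \<squnion>\<^bsub>M\<^esub> h y"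
      by (intro M.r_inj; auto simp: hc L.meet M.meet L.join M.join eq)+
  qed (rule h)
qed

lemma complete_boolean_hom_preimage:
  assumes L: "pow_rep X L r" and M: "pow_rep Y M s"
    and h: "h \<in> carrier L \<rightarrow> carrier M" and g: "g \<in> Y \<rightarrow> X"
    and eq: "\<And>x. x \<in> carrier L \<Longrightarrow> s (h x) = g -` r x \<inter> Y"
  shows "complete_boolean_hom L M h"
proof -
  interpret L: pow_rep X L r by fact
  interpret M: pow_rep Y M s by fact
  have hc: "h x \<in> carrier M" if "x \<in> carrier L" for x using h that by auto
  show ?thesis
    unfolding complete_boolean_hom_def
  proof (intro conjI allI impI)
    show "boolean_hom L M h"
      by (rule boolean_hom_preimage[OF L.set_rep_axioms M.set_rep_axioms h g eq])
    fix S assume S: "S \<subseteq> carrier L"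
    then have hS: "h ` S \<subseteq> carrier M" and *: "\<And>x. x \<in> S \<Longrightarrow> s (h x) = g -` r x \<inter> Y"
      using h eq by auto
    show "h (\<Sqinter>\<^bsub>L\<^esub>S) = \<Sqinter>\<^bsub>M\<^esub>(h ` S)"
      using g by (intro M.r_inj hc L.Inf M.Inf S hS) (auto simp: eq L.Inf[OF S] M.Inf[OF hS] *)
    show "h (\<Squnion>\<^bsub>L\<^esub>S) = \<Squnion>\<^bsub>M\<^esub>(h ` S)"
      by (intro M.r_inj hc L.Sup M.Sup S hS) (auto simp: eq L.Sup[OF S] M.Sup[OF hS] *)
  qed
qed

text \<open>If every atom below \<open>x\<close> is below \<open>y\<close>, no atom is left below
  the meet of \<open>x\<close> and a complement of \<open>y\<close>, so that meet is zero. For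
  surjectivity, the atoms below the join of \<open>T\<close> are just those in \<open>T\<close>;
  complements are used there in place of an infinite distributive law.\<close>

lemma atoms_pow_rep:
  assumes B: "complete_atomic_boolean_alg B"
  shows "pow_rep {a. is_atom B a} B (\<lambda>b. {a. is_atom B a \<and> a \<sqsubseteq>\<^bsub>B\<^esub> b})"
proof -
  let ?X = "{a. is_atom B a}" and ?r = "\<lambda>b. {a. is_atom B a \<and> a \<sqsubseteq>\<^bsub>B\<^esub> b}"
  interpret boolean_alg B using B by (simp add: complete_atomic_boolean_alg_def)
  interpret complete_lattice B using B by (simp add: complete_atomic_boolean_alg_def)
  have atom: "\<exists>a. is_atom B a \<and> a \<sqsubseteq>\<^bsub>B\<^esub> x" if "x \<in> carrier B" "x \<noteq> \<bottom>\<^bsub>B\<^esub>" for x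
    using B that by (simp add: complete_atomic_boolean_alg_def)
  have carr: "a \<in> carrier B" and nz: "a \<noteq> \<bottom>\<^bsub>B\<^esub>" if "is_atom B a" for a
    using that by (auto simp: is_atom_def)
  \<comment> \<open>Applied with \<open>y\<close> and \<open>z\<close> complementary, this turns
    disjointness from one into being below the other.\<close>
  have disj_le: "x \<sqsubseteq>\<^bsub>B\<^esub> z"
    if "x \<in> carrier B" "y \<in> carrier B" "z \<in> carrier B" "y \<squnion>\<^bsub>B\<^esub> z = \<top>\<^bsub>B\<^esub>" "x \<sqinter>\<^bsub>B\<^esub> y = \<bottom>\<^bsub>B\<^esub>" for x y z
  proof -
    have "x \<sqsubseteq>\<^bsub>B\<^esub> \<top>\<^bsub>B\<^esub>" using that(1) by (rule top_higher)
    then have "x \<sqsubseteq>\<^bsub>B\<^esub> x \<sqinter>\<^bsub>B\<^esub> (y \<squnion>\<^bsub>B\<^esub> z)"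
      using that by (intro meet_le) auto
    also have "x \<sqinter>\<^bsub>B\<^esub> (y \<squnion>\<^bsub>B\<^esub> z) = \<bottom>\<^bsub>B\<^esub> \<squnion>\<^bsub>B\<^esub> (x \<sqinter>\<^bsub>B\<^esub> z)"
      using meet_join_distrib[OF that(1-3)] that(5) by simp
    also have "\<dots> \<sqsubseteq>\<^bsub>B\<^esub> z"
      using that by (intro join_le bottom_lower meet_right) auto
    finally show ?thesis using that by simp
  qed
  have le_bot: "x = \<bottom>\<^bsub>B\<^esub>" if "x \<in> carrier B" "x \<sqsubseteq>\<^bsub>B\<^esub> y" "x \<sqsubseteq>\<^bsub>B\<^esub> z" "y \<in> carrier B" "z \<in> carrier B"
    "y \<sqinter>\<^bsub>B\<^esub> z = \<bottom>\<^bsub>B\<^esub>" for x y z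
    using that meet_le[of x y z] by (metis bottom_lower bottom_closed le_antisym)
  have le_iff: "x \<sqsubseteq>\<^bsub>B\<^esub> y \<longleftrightarrow> ?r x \<subseteq> ?r y" if x: "x \<in> carrier B" and y: "y \<in> carrier B" for x y
  proof
    show "?r x \<subseteq> ?r y" if "x \<sqsubseteq>\<^bsub>B\<^esub> y" using that x y carr le_trans by blast
    assume sub: "?r x \<subseteq> ?r y"
    obtain y' where y': "y' \<in> carrier B" "y \<sqinter>\<^bsub>B\<^esub> y' = \<bottom>\<^bsub>B\<^esub>" "y \<squnion>\<^bsub>B\<^esub> y' = \<top>\<^bsub>B\<^esub>"
      using complement_exists[OF y] by blast
    have "x \<sqinter>\<^bsub>B\<^esub> y' = \<bottom>\<^bsub>B\<^esub>"
    proof (rule ccontr)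
      assume "x \<sqinter>\<^bsub>B\<^esub> y' \<noteq> \<bottom>\<^bsub>B\<^esub>"
      then obtain a where a: "is_atom B a" "a \<sqsubseteq>\<^bsub>B\<^esub> x \<sqinter>\<^bsub>B\<^esub> y'"
        using atom[of "x \<sqinter>\<^bsub>B\<^esub> y'"] x y' by auto
      then have "a \<sqsubseteq>\<^bsub>B\<^esub> x" "a \<sqsubseteq>\<^bsub>B\<^esub> y'"
        using carr[OF a(1)] x y' by (meson meet_left meet_right meet_closed le_trans)+
      moreover have "a \<sqsubseteq>\<^bsub>B\<^esub> y" using sub a calculation by blast
      ultimately show False using le_bot[of a y y'] carr nz a y y' by blast
    qed
    moreover have "y' \<squnion>\<^bsub>B\<^esub> y = \<top>\<^bsub>B\<^esub>" using y' y by (metis join_comm)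
    ultimately show "x \<sqsubseteq>\<^bsub>B\<^esub> y" using disj_le[of x y' y] x y y' by blast
  qed
  have "bij_betw ?r (carrier B) (Pow ?X)"
    unfolding bij_betw_def
  proof
    show "inj_on ?r (carrier B)" by (rule inj_onI) (metis le_iff order_refl le_antisym)
    show "?r ` carrier B = Pow ?X"
    proof (intro equalityI subsetI)
      fix T assume T: "T \<in> Pow ?X"
      then have Tc: "T \<subseteq> carrier B" using carr by auto
      have "?r (\<Squnion>\<^bsub>B\<^esub>T) = T"
      proof (intro equalityI subsetI)
        fix a assume "a \<in> T"
        then show "a \<in> ?r (\<Squnion>\<^bsub>B\<^esub>T)" using T Tc sup_upper by auto
      next
        fix a assume "a \<in> ?r (\<Squnion>\<^bsub>B\<^esub>T)"
        then have a: "is_atom B a" "a \<sqsubseteq>\<^bsub>B\<^esub> \<Squnion>\<^bsub>B\<^esub>T" by auto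
        note ac = carr[OF a(1)]
        obtain a' where a': "a' \<in> carrier B" "a \<sqinter>\<^bsub>B\<^esub> a' = \<bottom>\<^bsub>B\<^esub>" "a \<squnion>\<^bsub>B\<^esub> a' = \<top>\<^bsub>B\<^esub>"
          using complement_exists[OF ac] by blast
        show "a \<in> T"
        proof (rule ccontr)
          assume "a \<notin> T"
          \<comment> \<open>Distinct atoms are disjoint, so the complement \<open>a'\<close> bounds
            \<open>T\<close>. Then \<open>a\<close> lies below the join of \<open>T\<close>, hence
            below its own complement, which is impossible for an atom.\<close>
          have "t \<sqsubseteq>\<^bsub>B\<^esub> a'" if t: "t \<in> T" for t
          proof -
            have ta: "is_atom B t" "t \<in> carrier B" "t \<noteq> a" using t T Tc \<open>a \<notin> T\<close> by auto
            have "t \<sqinter>\<^bsub>B\<^esub> a = \<bottom>\<^bsub>B\<^esub>"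
            proof (rule ccontr)
              assume "t \<sqinter>\<^bsub>B\<^esub> a \<noteq> \<bottom>\<^bsub>B\<^esub>"
              moreover have "t \<sqinter>\<^bsub>B\<^esub> a \<sqsubseteq>\<^bsub>B\<^esub> t" "t \<sqinter>\<^bsub>B\<^esub> a \<sqsubseteq>\<^bsub>B\<^esub> a" "t \<sqinter>\<^bsub>B\<^esub> a \<in> carrier B"
                using ta ac by (auto intro: meet_left meet_right)
              ultimately have "t \<sqinter>\<^bsub>B\<^esub> a = t" "t \<sqinter>\<^bsub>B\<^esub> a = a"
                using ta(1) a(1) unfolding is_atom_def by blast+
              then show False using ta by simp
            qed
            then show ?thesis using disj_le[of t a a'] ta ac a' by blast
          qed
          then have "\<Squnion>\<^bsub>B\<^esub>T \<sqsubseteq>\<^bsub>B\<^esub> a'" using sup_least[OF Tc] a' by blast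
          then have "a \<sqsubseteq>\<^bsub>B\<^esub> a'" using a ac a' Tc by (meson sup_closed le_trans)
          then show False using le_bot[of a a a'] ac nz a a' by auto
        qed
      qed
      then show "T \<in> ?r ` carrier B" using sup_closed[OF Tc] by (intro image_eqI[of _ _ "\<Squnion>\<^bsub>B\<^esub>T"]) auto
    qed auto
  qed
  then show ?thesis
    by (intro pow_repI set_rep.intro set_rep_axioms.intro algebra_Pow eq_is_equal le_iff)
qed

text \<open>An injective homomorphism makes \<open>A\<close> a field of sets by composing with the
  representation of \<open>B\<close>; closure under complements in \<open>X\<close> comes from the
  complements in \<open>A\<close>.\<close>

lemma subalgebra_rep:
  assumes B: "set_rep X \<B> B r" and A: "boolean_alg A" and h: "boolean_hom A B \<alpha>"
    and inj: "inj_on \<alpha> (carrier A)"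
  shows "set_rep X ((r \<circ> \<alpha>) ` carrier A) A (r \<circ> \<alpha>)"
proof -
  interpret B: set_rep X \<B> B r by fact
  interpret boolean_alg A by fact
  have hc: "\<alpha> x \<in> carrier B" if "x \<in> carrier A" for x
    using h that by (auto simp: boolean_hom_def)
  have h_meet: "r (\<alpha> (x \<sqinter>\<^bsub>A\<^esub> y)) = r (\<alpha> x) \<inter> r (\<alpha> y)" and h_join: "r (\<alpha> (x \<squnion>\<^bsub>A\<^esub> y)) = r (\<alpha> x) \<union> r (\<alpha> y)"
    if "x \<in> carrier A" "y \<in> carrier A" for x y
    using h that hc B.meet B.join by (auto simp: boolean_hom_def)
  have h_bot: "r (\<alpha> \<bottom>\<^bsub>A\<^esub>) = {}" and h_top: "r (\<alpha> \<top>\<^bsub>A\<^esub>) = X"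
    using h B.bottom B.top by (auto simp: boolean_hom_def)
  have inj': "inj_on (r \<circ> \<alpha>) (carrier A)"
    using inj hc B.r_inj by (auto simp: inj_on_def)
  let ?\<A> = "(r \<circ> \<alpha>) ` carrier A"
  have alg: "algebra X ?\<A>"
    unfolding algebra_iff_Un
  proof (intro conjI ballI)
    show "?\<A> \<subseteq> Pow X" using hc B.r_sub by auto
    show "{} \<in> ?\<A>" using h_bot by (metis bottom_closed comp_apply imageI)
    fix U assume "U \<in> ?\<A>"
    then obtain x where x: "x \<in> carrier A" "U = r (\<alpha> x)" by auto
    obtain y where y: "y \<in> carrier A" "x \<sqinter>\<^bsub>A\<^esub> y = \<bottom>\<^bsub>A\<^esub>" "x \<squnion>\<^bsub>A\<^esub> y = \<top>\<^bsub>A\<^esub>"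
      using complement_exists[OF x(1)] by blast
    have "X - U = r (\<alpha> y)"
      using h_meet[OF x(1) y(1)] h_join[OF x(1) y(1)] h_bot h_top x y by auto
    then show "X - U \<in> ?\<A>" using y by auto
    fix V assume "V \<in> ?\<A>"
    then obtain z where z: "z \<in> carrier A" "V = r (\<alpha> z)" by auto
    then show "U \<union> V \<in> ?\<A>" using x h_join[OF x(1) z(1)] by (metis comp_apply imageI join_closed)
  qed
  show ?thesis
  proof (intro set_rep.intro set_rep_axioms.intro alg eq_is_equal)
    show "bij_betw (r \<circ> \<alpha>) (carrier A) ?\<A>" using inj' by (simp add: bij_betw_def)
    fix x y assume xy: "x \<in> carrier A" "y \<in> carrier A"
    \<comment> \<open>The order is expressed by the meet, because an equation of meets is both
      preserved and reflected by an injective homomorphism.\<close>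
    have "x \<sqsubseteq>\<^bsub>A\<^esub> y \<longleftrightarrow> x \<sqinter>\<^bsub>A\<^esub> y = x"
      using xy by (metis le_antisym meet_le meet_left meet_right meet_closed le_refl)
    also have "\<dots> \<longleftrightarrow> (r \<circ> \<alpha>) (x \<sqinter>\<^bsub>A\<^esub> y) = (r \<circ> \<alpha>) x"
      using inj_on_eq_iff[OF inj' meet_closed[OF xy] xy(1)] by simp
    also have "\<dots> \<longleftrightarrow> (r \<circ> \<alpha>) x \<subseteq> (r \<circ> \<alpha>) y"
      using h_meet[OF xy] by auto
    finally show "x \<sqsubseteq>\<^bsub>A\<^esub> y \<longleftrightarrow> (r \<circ> \<alpha>) x \<subseteq> (r \<circ> \<alpha>) y" .
  qed
qed

text \<open>A point \<open>y\<close> determines the ultrafilter of all \<open>x\<close> with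
  \<open>y \<in> s (h x)\<close>. It suffices to find \<open>p\<close> in all its members: the
  ultrafilter contains \<open>x\<close> or its complement, so conversely \<open>p \<in> r x\<close>
  forces \<open>y \<in> s (h x)\<close>. Such a \<open>p\<close> is found for complete homomorphisms
  by principality, and for compact spaces by a finite intersection argument.\<close>

lemma hom_point_mapI:
  assumes L: "set_rep X \<A> L r" and M: "set_rep Y \<B> M s" and h: "boolean_hom L M h"
    and pt: "\<And>y. y \<in> Y \<Longrightarrow> \<exists>p\<in>X. \<forall>x\<in>carrier L. y \<in> s (h x) \<longrightarrow> p \<in> r x"
  shows "\<exists>g\<in>Y \<rightarrow> X. \<forall>x\<in>carrier L. s (h x) = g -` r x \<inter> Y"
proof -
  interpret L: set_rep X \<A> L r by fact
  interpret M: set_rep Y \<B> M s by fact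
  have hc: "h x \<in> carrier M" if "x \<in> carrier L" for x
    using h that by (auto simp: boolean_hom_def)
  obtain g where g: "\<forall>y\<in>Y. g y \<in> X \<and> (\<forall>x\<in>carrier L. y \<in> s (h x) \<longrightarrow> g y \<in> r x)"
    using bchoice[of Y "\<lambda>y p. p \<in> X \<and> (\<forall>x\<in>carrier L. y \<in> s (h x) \<longrightarrow> p \<in> r x)"] pt by blast
  have "y \<in> s (h x)" if x: "x \<in> carrier L" and y: "y \<in> Y" "g y \<in> r x" for x y
  proof (rule ccontr)
    assume ny: "y \<notin> s (h x)"
    obtain x' where x': "x' \<in> carrier L" "r x' = X - r x" by (rule L.compl[OF x])
    have "x \<squnion>\<^bsub>L\<^esub> x' = \<top>\<^bsub>L\<^esub>"
      using x x' L.r_sub[OF x] by (intro L.r_inj) (auto simp: L.join L.top)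
    then have "s (h x) \<union> s (h x') = Y"
      using h M.join[OF hc[OF x] hc[OF x'(1)]] M.top x x' by (metis boolean_hom_def)
    then have "g y \<in> r x'" using g ny x' y by auto
    then show False using x' y by auto
  qed
  then show ?thesis
    using g M.r_sub[OF hc] by (intro bexI[of _ g] ballI equalityI subsetI) (blast | auto)+
qed

text \<open>The ultrafilter at \<open>y\<close> is principal: the top of \<open>L\<close> is the
  join of the elements with singleton sets, \<open>h\<close> preserves this join, and therefore the
  image of one of these elements contains \<open>y\<close>.\<close>

lemma complete_hom_point_map:
  assumes L: "pow_rep X L r" and M: "pow_rep Y M s" and h: "complete_boolean_hom L M h"
  shows "\<exists>f\<in>Y \<rightarrow> X. \<forall>x\<in>carrier L. s (h x) = f -` r x \<inter> Y"
proof -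
  interpret L: pow_rep X L r by fact
  interpret M: pow_rep Y M s by fact
  have bh: "boolean_hom L M h" using h by (simp add: complete_boolean_hom_def)
  have hc: "h x \<in> carrier M" if "x \<in> carrier L" for x
    using bh that by (auto simp: boolean_hom_def)
  let ?S = "{x \<in> carrier L. \<exists>p\<in>X. r x = {p}}"
  have S: "?S \<subseteq> carrier L" by auto
  have "p \<in> \<Union>(r ` ?S)" if "p \<in> X" for p
    using L.r_surj[of "{p}"] that by auto
  then have "\<Squnion>\<^bsub>L\<^esub>?S = \<top>\<^bsub>L\<^esub>"
    by (intro L.r_inj L.Sup L.top S) (auto simp: L.Sup[OF S] L.top)
  moreover have "h (\<Squnion>\<^bsub>L\<^esub>?S) = \<Squnion>\<^bsub>M\<^esub>(h ` ?S)" "h \<top>\<^bsub>L\<^esub> = \<top>\<^bsub>M\<^esub>"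
    using h bh S by (auto simp: complete_boolean_hom_def boolean_hom_def)
  ultimately have cover: "Y = \<Union>(s ` h ` ?S)"
    using M.Sup(3)[of "h ` ?S"] M.top hc by auto
  show ?thesis
  proof (rule hom_point_mapI[OF L.set_rep_axioms M.set_rep_axioms bh])
    fix y assume "y \<in> Y"
    then obtain a p where a: "a \<in> carrier L" "p \<in> X" "r a = {p}" "y \<in> s (h a)"
      using cover by auto
    \<comment> \<open>Otherwise \<open>a\<close> and \<open>x\<close> are disjoint, and so are their
      images, although both contain \<open>y\<close>.\<close>
    have "p \<in> r x" if x: "x \<in> carrier L" "y \<in> s (h x)" for x
    proof (rule ccontr)
      assume "p \<notin> r x"
      then have "a \<sqinter>\<^bsub>L\<^esub> x = \<bottom>\<^bsub>L\<^esub>"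
        using a x by (intro L.r_inj) (auto simp: L.meet L.bottom)
      then have "s (h a) \<inter> s (h x) = {}"
        using bh M.meet[OF hc[OF a(1)] hc[OF x(1)]] M.bottom a x by (metis boolean_hom_def)
      then show False using a x by auto
    qed
    then show "\<exists>p\<in>X. \<forall>x\<in>carrier L. y \<in> s (h x) \<longrightarrow> p \<in> r x" using a by blast
  qed
qed

text \<open>The members of the ultrafilter at \<open>y\<close> are closed sets with the finite
  intersection property, so compactness yields a common point.\<close>

lemma compact_hom_point_map:
  assumes L: "set_rep (topspace T) \<A> L r" and M: "set_rep Y \<B> M s" and h: "boolean_hom L M h"
    and T: "compact_space T" "\<And>U. U \<in> \<A> \<Longrightarrow> closedin T U"
  shows "\<exists>g\<in>Y \<rightarrow> topspace T. \<forall>x\<in>carrier L. s (h x) = g -` r x \<inter> Y"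
proof (rule hom_point_mapI[OF L M h])
  interpret L: set_rep "topspace T" \<A> L r by fact
  interpret M: set_rep Y \<B> M s by fact
  have hc: "h x \<in> carrier M" if "x \<in> carrier L" for x
    using h that by (auto simp: boolean_hom_def)
  fix y assume y: "y \<in> Y"
  let ?S = "{x \<in> carrier L. y \<in> s (h x)}"
  \<comment> \<open>Used twice: as the base case for finite meets, and at the end to place the
    common point in \<open>topspace T\<close>.\<close>
  have top: "\<top>\<^bsub>L\<^esub> \<in> ?S"
    using h L.top M.top y by (auto simp: boolean_hom_def)
  \<comment> \<open>Below finitely many members there is a single one. It then remains to see that
    no member is empty, which holds because \<open>h\<close> preserves the bottom.\<close>
  have fin: "\<exists>z\<in>?S. r z \<subseteq> \<Inter>(r ` F)" if "finite F" "F \<subseteq> ?S" for F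
    using that
  proof (induction F)
    case empty
    then show ?case using top by auto
  next
    case (insert x F)
    then obtain z where z: "z \<in> carrier L" "y \<in> s (h z)" "r z \<subseteq> \<Inter>(r ` F)" by auto
    have x: "x \<in> carrier L" "y \<in> s (h x)" using insert by auto
    have "y \<in> s (h (x \<sqinter>\<^bsub>L\<^esub> z))"
      using h M.meet[OF hc[OF x(1)] hc[OF z(1)]] x z by (auto simp: boolean_hom_def)
    then show ?case
      using L.meet[OF x(1) z(1)] z by (intro bexI[of _ "x \<sqinter>\<^bsub>L\<^esub> z"]) auto
  qed
  have "\<Inter>(r ` ?S) \<noteq> {}"
  proof (rule compact_space_fip[THEN iffD1, OF T(1), rule_format])
    show "(\<forall>C\<in>r ` ?S. closedin T C) \<and> (\<forall>\<F>. finite \<F> \<and> \<F> \<subseteq> r ` ?S \<longrightarrow> \<Inter>\<F> \<noteq> {})"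
    proof (intro conjI ballI allI impI)
      fix C assume "C \<in> r ` ?S"
      then show "closedin T C" using T(2) L.r_in by auto
    next
      fix \<F> assume "finite \<F> \<and> \<F> \<subseteq> r ` ?S"
      then obtain F where F: "finite F" "F \<subseteq> ?S" "\<F> = r ` F" by (meson finite_subset_image)
      then obtain z where z: "z \<in> carrier L" "y \<in> s (h z)" "r z \<subseteq> \<Inter>\<F>" using fin by blast
      have "r z \<noteq> {}"
      proof
        assume "r z = {}"
        then have "z = \<bottom>\<^bsub>L\<^esub>" using z L.bottom by (intro L.r_inj) auto
        then show False using h z M.bottom by (auto simp: boolean_hom_def)
      qed
      then show "\<Inter>\<F> \<noteq> {}" using z by auto
    qed
  qed
  then obtain p where p: "\<forall>x\<in>?S. p \<in> r x" by auto
  then have "p \<in> topspace T" using top L.top by auto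
  then show "\<exists>p\<in>topspace T. \<forall>x\<in>carrier L. y \<in> s (h x) \<longrightarrow> p \<in> r x" using p by blast
qed

section \<open>Clopen sets and the two categories\<close>

definition clopens :: "'a topology \<Rightarrow> 'a set set" where
  "clopens Y = {V. openin Y V \<and> closedin Y V}"

lemma algebra_clopens: "algebra (topspace Y) (clopens Y)"
  unfolding algebra_iff_Un clopens_def
  by (auto dest: openin_subset intro: openin_diff)

lemma clopens_subset: "V \<in> clopens Y \<Longrightarrow> V \<subseteq> topspace Y"
  by (auto simp: clopens_def dest: openin_subset)

lemma clopens_preimage:
  assumes "continuous_map Y Y' g" "V \<in> clopens Y'"
  shows "g -` V \<inter> topspace Y \<in> clopens Y"
proof -
  have "g -` V \<inter> topspace Y = {y \<in> topspace Y. g y \<in> V}" by auto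
  then show ?thesis
    using assms openin_continuous_map_preimage closedin_continuous_map_preimage
    unfolding clopens_def by auto
qed

lemma zero_dimensional_clopen_base:
  assumes "zero_dimensional_space Y" "openin Y U" "p \<in> U"
  shows "\<exists>V\<in>clopens Y. p \<in> V \<and> V \<subseteq> U"
proof -
  obtain \<B> where \<B>: "\<forall>V\<in>\<B>. openin Y V \<and> closedin Y V" "openin Y = arbitrary union_of (\<lambda>V. V \<in> \<B>)"
    using assms(1) unfolding zero_dimensional_space_def by blast
  then obtain \<C> where "\<C> \<subseteq> \<B>" "\<Union>\<C> = U"
    using assms(2) by (auto simp: union_of_def arbitrary_def)
  then show ?thesis using \<B>(1) assms(3) unfolding clopens_def by blast
qed

lemma clopens_separate:
  assumes "zero_dimensional_space Y" "Hausdorff_space Y" "p \<in> topspace Y" "q \<in> topspace Y" "p \<noteq> q"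
  shows "\<exists>V\<in>clopens Y. p \<in> V \<and> q \<notin> V"
proof -
  obtain U W where "openin Y U" "p \<in> U" "q \<in> W" "disjnt U W"
    using assms(2-) unfolding Hausdorff_space_def by metis
  then show ?thesis
    using zero_dimensional_clopen_base[OF assms(1), of U p] by (auto simp: disjnt_iff)
qed

text \<open>The difference of two clopen sets with the same trace on \<open>D\<close> is open and
  misses \<open>D\<close>, hence misses the closure of \<open>D\<close>, which is the whole
  space.\<close>

lemma clopens_dense_eq:
  assumes "Y closure_of D = topspace Y" "V \<in> clopens Y" "W \<in> clopens Y" "V \<inter> D = W \<inter> D"
  shows "V = W"
proof -
  have *: "A \<subseteq> B" if "A \<in> clopens Y" "B \<in> clopens Y" "A \<inter> D = B \<inter> D" for A B
  proof -
    have "openin Y (A - B)" using that by (auto simp: clopens_def intro: openin_diff)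
    moreover have "(A - B) \<inter> D = {}" using that by auto
    ultimately have "(A - B) \<inter> Y closure_of D = {}"
      using openin_Int_closure_of_eq_empty by metis
    moreover have "A - B \<subseteq> topspace Y" using clopens_subset that(1) by blast
    ultimately show ?thesis using assms(1) by auto
  qed
  show ?thesis using *[of V W] *[of W V] assms by auto
qed

lemma continuous_map_clopen_base:
  assumes "zero_dimensional_space Y'" "g \<in> topspace Y \<rightarrow> topspace Y'"
    and "\<And>V. V \<in> clopens Y' \<Longrightarrow> g -` V \<inter> topspace Y \<in> clopens Y"
  shows "continuous_map Y Y' g"
  unfolding continuous_map
proof (intro conjI allI impI)
  show "g ` topspace Y \<subseteq> topspace Y'" using assms(2) by auto
  fix U assume U: "openin Y' U"
  show "openin Y {x \<in> topspace Y. g x \<in> U}"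
  proof (subst openin_subopen, intro ballI)
    fix x assume x: "x \<in> {x \<in> topspace Y. g x \<in> U}"
    then obtain V where V: "V \<in> clopens Y'" "g x \<in> V" "V \<subseteq> U"
      using zero_dimensional_clopen_base[OF assms(1) U, of "g x"] by blast
    then show "\<exists>T. openin Y T \<and> x \<in> T \<and> T \<subseteq> {x \<in> topspace Y. g x \<in> U}"
      using assms(3)[OF V(1)] x by (intro exI[of _ "g -` V \<inter> topspace Y"]) (auto simp: clopens_def)
  qed
qed

section \<open>Identities and composites of Boolean homomorphisms\<close>

lemma boolean_hom_id: "boolean_alg L \<Longrightarrow> boolean_hom L L (\<lambda>x\<in>carrier L. x)"
proof -
  assume "boolean_alg L"
  then interpret boolean_alg L .
  show ?thesis by (auto simp: boolean_hom_def)
qed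

lemma complete_boolean_hom_id:
  assumes "complete_atomic_boolean_alg L"
  shows "complete_boolean_hom L L (\<lambda>x\<in>carrier L. x)"
proof -
  interpret complete_lattice L using assms by (simp add: complete_atomic_boolean_alg_def)
  have "(\<lambda>x\<in>carrier L. x) ` S = S" if "S \<subseteq> carrier L" for S using that by (auto simp: subset_iff)
  then show ?thesis
    using assms boolean_hom_id[of L] by (auto simp: complete_boolean_hom_def complete_atomic_boolean_alg_def)
qed

lemma boolean_hom_compose:
  assumes "boolean_alg L" and h: "boolean_hom L M h" and k: "boolean_hom M N k"
  shows "boolean_hom L N (compose (carrier L) k h)"
proof -
  interpret boolean_alg L by fact
  have "h x \<in> carrier M" if "x \<in> carrier L" for x using h that by (auto simp: boolean_hom_def)
  then show ?thesis using h k by (auto simp: boolean_hom_def compose_def)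
qed

lemma complete_boolean_hom_compose:
  assumes L: "complete_atomic_boolean_alg L" and h: "complete_boolean_hom L M h"
    and k: "complete_boolean_hom M N k"
  shows "complete_boolean_hom L N (compose (carrier L) k h)"
proof -
  interpret complete_lattice L using L by (simp add: complete_atomic_boolean_alg_def)
  have hc: "h x \<in> carrier M" if "x \<in> carrier L" for x
    using h that by (auto simp: boolean_hom_def complete_boolean_hom_def)
  show ?thesis
    unfolding complete_boolean_hom_def
  proof (intro conjI allI impI)
    show "boolean_hom L N (compose (carrier L) k h)"
      using L h k boolean_hom_compose[of L M h N k]
      by (simp add: complete_boolean_hom_def complete_atomic_boolean_alg_def)
    fix S assume S: "S \<subseteq> carrier L"
    then have im: "compose (carrier L) k h ` S = k ` h ` S" and hS: "h ` S \<subseteq> carrier M"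
      using hc by (auto simp: compose_def subset_iff image_image)
    show "compose (carrier L) k h (\<Sqinter>\<^bsub>L\<^esub>S) = \<Sqinter>\<^bsub>N\<^esub>(compose (carrier L) k h ` S)"
      "compose (carrier L) k h (\<Squnion>\<^bsub>L\<^esub>S) = \<Squnion>\<^bsub>N\<^esub>(compose (carrier L) k h ` S)"
      unfolding im using h k S hS by (simp_all add: complete_boolean_hom_def compose_eq)
  qed
qed

section \<open>Boolean z-maps form a category\<close>

lemma zMaps_objs:
  "Z \<in> objs (zMaps_cat \<U>) \<longleftrightarrow> carrier (dalg Z) \<in> \<U> \<and> carrier (calg Z) \<in> \<U> \<and>
     amap Z \<in> extensional (carrier (dalg Z)) \<and> boolean_z_map (dalg Z) (calg Z) (amap Z)"
  by (simp add: zMaps_cat_def)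

lemma zMaps_homs:
  "(\<phi>, \<sigma>) \<in> homs (zMaps_cat \<U>) Z Z' \<longleftrightarrow>
     \<phi> \<in> extensional (carrier (dalg Z)) \<and> boolean_hom (dalg Z) (dalg Z') \<phi> \<and>
     \<sigma> \<in> extensional (carrier (calg Z)) \<and> complete_boolean_hom (calg Z) (calg Z') \<sigma> \<and>
     (\<forall>x\<in>carrier (dalg Z). amap Z' (\<phi> x) = \<sigma> (amap Z x))"
  by (simp add: zMaps_cat_def)

lemma zMaps_compn:
  "compn (zMaps_cat \<U>) Z Z' Z'' (\<phi>', \<sigma>') (\<phi>, \<sigma>) =
     (compose (carrier (dalg Z)) \<phi>' \<phi>, compose (carrier (calg Z)) \<sigma>' \<sigma>)"
  by (simp add: zMaps_cat_def)

lemma zMaps_ident: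
  "ident (zMaps_cat \<U>) Z = (\<lambda>x\<in>carrier (dalg Z). x, \<lambda>y\<in>carrier (calg Z). y)"
  by (simp add: zMaps_cat_def)

lemma category_zMaps: "category (zMaps_cat \<U>)"
  unfolding category_def
proof (intro conjI ballI)
  fix Z assume Z: "Z \<in> objs (zMaps_cat \<U>)"
  \<comment> \<open>The identity arrow is restricted to \<open>carrier (calg Z)\<close>; its square
    commutes because \<open>amap Z\<close> takes its values there.\<close>
  have "amap Z \<in> carrier (dalg Z) \<rightarrow> carrier (calg Z)"
    using Z by (auto simp: zMaps_objs boolean_z_map_def boolean_hom_def)
  then show "ident (zMaps_cat \<U>) Z \<in> homs (zMaps_cat \<U>) Z Z"
    using Z by (auto simp: zMaps_ident zMaps_homs zMaps_objs boolean_z_map_def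
        intro: boolean_hom_id complete_boolean_hom_id)
next
  fix Z1 Z2 Z3 p q
  assume Z: "Z1 \<in> objs (zMaps_cat \<U>)" "Z2 \<in> objs (zMaps_cat \<U>)" "Z3 \<in> objs (zMaps_cat \<U>)"
    and p: "p \<in> homs (zMaps_cat \<U>) Z1 Z2" and q: "q \<in> homs (zMaps_cat \<U>) Z2 Z3"
  obtain \<phi> \<sigma> \<psi> \<tau> where eq: "p = (\<phi>, \<sigma>)" "q = (\<psi>, \<tau>)" by (metis surj_pair)
  have "amap Z1 \<in> carrier (dalg Z1) \<rightarrow> carrier (calg Z1)"
    using Z by (auto simp: zMaps_objs boolean_z_map_def boolean_hom_def)
  moreover have "\<phi> \<in> carrier (dalg Z1) \<rightarrow> carrier (dalg Z2)" "\<sigma> \<in> carrier (calg Z1) \<rightarrow> carrier (calg Z2)"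
    using p by (auto simp: eq zMaps_homs boolean_hom_def complete_boolean_hom_def)
  ultimately show "compn (zMaps_cat \<U>) Z1 Z2 Z3 q p \<in> homs (zMaps_cat \<U>) Z1 Z3"
    using Z p q unfolding eq zMaps_compn zMaps_homs
    by (auto simp: zMaps_objs boolean_z_map_def compose_eq Pi_iff
        intro: boolean_hom_compose complete_boolean_hom_compose)
next
  fix Z1 Z2 p
  assume "p \<in> homs (zMaps_cat \<U>) Z1 Z2"
  moreover obtain \<phi> \<sigma> where eq: "p = (\<phi>, \<sigma>)" by (metis surj_pair)
  ultimately have "\<phi> \<in> carrier (dalg Z1) \<rightarrow> carrier (dalg Z2)" "\<sigma> \<in> carrier (calg Z1) \<rightarrow> carrier (calg Z2)"
      "\<phi> \<in> extensional (carrier (dalg Z1))" "\<sigma> \<in> extensional (carrier (calg Z1))"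
    by (auto simp: eq zMaps_homs boolean_hom_def complete_boolean_hom_def)
  then show "compn (zMaps_cat \<U>) Z1 Z1 Z2 p (ident (zMaps_cat \<U>) Z1) = p"
    "compn (zMaps_cat \<U>) Z1 Z2 Z2 (ident (zMaps_cat \<U>) Z2) p = p"
    by (simp_all add: eq zMaps_ident zMaps_compn compose_Id Id_compose)
next
  fix Z1 Z2 Z3 Z4 p q s
  assume p: "p \<in> homs (zMaps_cat \<U>) Z1 Z2"
    and "q \<in> homs (zMaps_cat \<U>) Z2 Z3" "s \<in> homs (zMaps_cat \<U>) Z3 Z4"
  obtain \<phi> \<sigma> \<psi> \<tau> \<omega> \<rho> where eq: "p = (\<phi>, \<sigma>)" "q = (\<psi>, \<tau>)" "s = (\<omega>, \<rho>)" by (metis surj_pair)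
  have "\<phi> \<in> carrier (dalg Z1) \<rightarrow> carrier (dalg Z2)" "\<sigma> \<in> carrier (calg Z1) \<rightarrow> carrier (calg Z2)"
    using p by (auto simp: eq zMaps_homs boolean_hom_def complete_boolean_hom_def)
  then show "compn (zMaps_cat \<U>) Z1 Z2 Z4 (compn (zMaps_cat \<U>) Z2 Z3 Z4 s q) p =
      compn (zMaps_cat \<U>) Z1 Z3 Z4 s (compn (zMaps_cat \<U>) Z1 Z2 Z3 q p)"
    by (simp add: eq zMaps_compn compose_assoc)
qed

section \<open>Zero-dimensional compactifications form a category\<close>

lemma ZComp_objs:
  "K \<in> objs (ZComp_cat \<U>) \<longleftrightarrow> topspace (src K) \<in> \<U> \<and> topspace (tgt K) \<in> \<U> \<and>
     cmap K \<in> extensional (topspace (src K)) \<and>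
     hausdorff_compactification (src K) (tgt K) (cmap K) \<and> zero_dimensional_space (tgt K)"
  by (auto simp: ZComp_cat_def full_subcategory_def Comp_cat_def)

lemma ZComp_homs:
  "(f, g) \<in> homs (ZComp_cat \<U>) K K' \<longleftrightarrow>
     f \<in> extensional (topspace (src K)) \<and> continuous_map (src K) (src K') f \<and>
     g \<in> extensional (topspace (tgt K)) \<and> continuous_map (tgt K) (tgt K') g \<and>
     (\<forall>x\<in>topspace (src K). g (cmap K x) = cmap K' (f x))"
  by (simp add: ZComp_cat_def full_subcategory_def Comp_cat_def)

lemma ZComp_compn:
  "compn (ZComp_cat \<U>) K K' K'' (f', g') (f, g) =
     (compose (topspace (src K)) f' f, compose (topspace (tgt K)) g' g)"
  by (simp add: ZComp_cat_def full_subcategory_def Comp_cat_def)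

lemma ZComp_ident:
  "ident (ZComp_cat \<U>) K = (\<lambda>x\<in>topspace (src K). x, \<lambda>y\<in>topspace (tgt K). y)"
  by (simp add: ZComp_cat_def full_subcategory_def Comp_cat_def)

lemma hausdorff_compactification_continuous:
  "hausdorff_compactification X Y c \<Longrightarrow> continuous_map X Y c"
  using homeomorphic_imp_continuous_map[of X "subtopology Y (c ` topspace X)" c]
  unfolding hausdorff_compactification_def embedding_map_def by (auto simp: continuous_map_in_subtopology)

lemma hausdorff_compactification_funcset:
  "hausdorff_compactification X Y c \<Longrightarrow> c \<in> topspace X \<rightarrow> topspace Y"
  by (intro continuous_map_funspace hausdorff_compactification_continuous)

lemma continuous_map_compose_on:
  "continuous_map X Y f \<Longrightarrow> continuous_map Y Z g \<Longrightarrow> continuous_map X Z (compose (topspace X) g f)"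
  by (rule continuous_map_eq[OF continuous_map_compose[of X Y f Z g]]) (auto simp: compose_eq)

lemma category_ZComp: "category (ZComp_cat \<U>)"
  unfolding category_def
proof (intro conjI ballI)
  fix K assume K: "K \<in> objs (ZComp_cat \<U>)"
  have id: "continuous_map X X (\<lambda>x\<in>topspace X. x)" for X :: "'a topology"
    by (rule continuous_map_eq[OF continuous_map_id]) auto
  have "cmap K \<in> topspace (src K) \<rightarrow> topspace (tgt K)"
    using K hausdorff_compactification_funcset by (auto simp: ZComp_objs)
  then show "ident (ZComp_cat \<U>) K \<in> homs (ZComp_cat \<U>) K K"
    using id by (auto simp: ZComp_ident ZComp_homs)
next
  fix K1 K2 K3 p q
  assume K: "K1 \<in> objs (ZComp_cat \<U>)" "K2 \<in> objs (ZComp_cat \<U>)" "K3 \<in> objs (ZComp_cat \<U>)"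
    and p: "p \<in> homs (ZComp_cat \<U>) K1 K2" and q: "q \<in> homs (ZComp_cat \<U>) K2 K3"
  obtain f g f' g' where eq: "p = (f, g)" "q = (f', g')" by (metis surj_pair)
  have "cmap K1 \<in> topspace (src K1) \<rightarrow> topspace (tgt K1)"
    using K hausdorff_compactification_funcset by (auto simp: ZComp_objs)
  moreover have "f \<in> topspace (src K1) \<rightarrow> topspace (src K2)" "g \<in> topspace (tgt K1) \<rightarrow> topspace (tgt K2)"
    using p continuous_map_funspace unfolding eq ZComp_homs by blast+
  ultimately show "compn (ZComp_cat \<U>) K1 K2 K3 q p \<in> homs (ZComp_cat \<U>) K1 K3"
    using p q unfolding eq ZComp_compn ZComp_homs
    by (auto simp: compose_eq Pi_iff intro: continuous_map_compose_on)
next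
  fix K1 K2 p
  assume p: "p \<in> homs (ZComp_cat \<U>) K1 K2"
  obtain f g where eq: "p = (f, g)" by (metis surj_pair)
  have "f \<in> topspace (src K1) \<rightarrow> topspace (src K2)" "g \<in> topspace (tgt K1) \<rightarrow> topspace (tgt K2)"
      "f \<in> extensional (topspace (src K1))" "g \<in> extensional (topspace (tgt K1))"
    using p continuous_map_funspace unfolding eq ZComp_homs by blast+
  then show "compn (ZComp_cat \<U>) K1 K1 K2 p (ident (ZComp_cat \<U>) K1) = p"
    "compn (ZComp_cat \<U>) K1 K2 K2 (ident (ZComp_cat \<U>) K2) p = p"
    by (simp_all add: eq ZComp_ident ZComp_compn compose_Id Id_compose)
next
  fix K1 K2 K3 K4 p q s
  assume p: "p \<in> homs (ZComp_cat \<U>) K1 K2"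
    and "q \<in> homs (ZComp_cat \<U>) K2 K3" "s \<in> homs (ZComp_cat \<U>) K3 K4"
  obtain f g f' g' f'' g'' where eq: "p = (f, g)" "q = (f', g')" "s = (f'', g'')" by (metis surj_pair)
  have "f \<in> topspace (src K1) \<rightarrow> topspace (src K2)" "g \<in> topspace (tgt K1) \<rightarrow> topspace (tgt K2)"
    using p continuous_map_funspace unfolding eq ZComp_homs by blast+
  then show "compn (ZComp_cat \<U>) K1 K2 K4 (compn (ZComp_cat \<U>) K2 K3 K4 s q) p =
      compn (ZComp_cat \<U>) K1 K3 K4 s (compn (ZComp_cat \<U>) K1 K2 K3 q p)"
    by (simp add: eq ZComp_compn compose_assoc)
qed

section \<open>The clopen functor\<close>

text \<open>\<open>e S\<close> codes subsets of \<open>S\<close> by elements of \<open>'u\<close>.\<close>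

locale encoded_universe =
  fixes \<U> :: "'u set set" and e :: "'u set \<Rightarrow> 'u set \<Rightarrow> 'u"
  assumes lepoll_closed: "S \<in> \<U> \<Longrightarrow> T \<lesssim> S \<Longrightarrow> T \<in> \<U>"
    and inj_e: "S \<in> \<U> \<Longrightarrow> inj_on (e S) (Pow S)"
    and e_small: "S \<in> \<U> \<Longrightarrow> e S ` Pow S \<in> \<U>"
begin

lemma subset_closed: "S \<in> \<U> \<Longrightarrow> T \<subseteq> S \<Longrightarrow> T \<in> \<U>"
  by (erule lepoll_closed) (rule subset_imp_lepoll)

definition dec :: "'u set \<Rightarrow> 'u \<Rightarrow> 'u set" where
  "dec S = inv_into (Pow S) (e S)"

text \<open>The carrier consists of codes, since it must be a set of elements of \<open>'u\<close>;
  the order compares the sets behind the codes, and \<open>dec S\<close> is the representation in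
  the sense of \<open>set_rep\<close>.\<close>

definition set_alg :: "'u set \<Rightarrow> 'u set set \<Rightarrow> 'u gorder" where
  "set_alg S \<A> = \<lparr>carrier = e S ` \<A>, eq = (=), le = (\<lambda>x y. dec S x \<subseteq> dec S y)\<rparr>"

text \<open>The preimage map conjugated by the codes. Restriction to the codes of members of
  \<open>\<A>\<close> makes it extensional, as arrows must be.\<close>

definition preim :: "'u set \<Rightarrow> 'u set \<Rightarrow> 'u set set \<Rightarrow> ('u \<Rightarrow> 'u) \<Rightarrow> 'u \<Rightarrow> 'u" where
  "preim S T \<A> f = (\<lambda>a\<in>e T ` \<A>. e S (f -` dec T a \<inter> S))"

definition clopen_functor ::
    "('u top_map, ('u \<Rightarrow> 'u) \<times> ('u \<Rightarrow> 'u), 'u alg_map, ('u \<Rightarrow> 'u) \<times> ('u \<Rightarrow> 'u)) fctr" where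
  "clopen_functor =
     \<lparr>fobj = (\<lambda>K. \<lparr>dalg = set_alg (topspace (tgt K)) (clopens (tgt K)),
                   calg = set_alg (topspace (src K)) (Pow (topspace (src K))),
                   amap = preim (topspace (src K)) (topspace (tgt K)) (clopens (tgt K)) (cmap K)\<rparr>),
      fmap = (\<lambda>K K' (f, g).
        (preim (topspace (tgt K)) (topspace (tgt K')) (clopens (tgt K')) g,
         preim (topspace (src K)) (topspace (src K')) (Pow (topspace (src K'))) f))\<rparr>"

lemma carrier_set_alg: "carrier (set_alg S \<A>) = e S ` \<A>"
  by (simp add: set_alg_def)

lemma dec_e: "S \<in> \<U> \<Longrightarrow> V \<subseteq> S \<Longrightarrow> dec S (e S V) = V"
  unfolding dec_def by (intro inv_into_f_f inj_e) auto

lemma set_alg_rep: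
  assumes S: "S \<in> \<U>" and \<A>: "algebra S \<A>"
  shows "set_rep S \<A> (set_alg S \<A>) (dec S)"
proof (intro set_rep.intro set_rep_axioms.intro \<A>)
  have sub: "\<A> \<subseteq> Pow S" using \<A> by (simp add: algebra_iff_Un)
  have "dec S (e S V) = V" if "V \<in> \<A>" for V
    using sub that by (intro dec_e[OF S]) auto
  then show "bij_betw (dec S) (carrier (set_alg S \<A>)) \<A>"
    unfolding carrier_set_alg by (intro bij_betwI[of _ _ _ "e S"]) auto
qed (simp_all add: set_alg_def)

lemma set_alg_pow_rep: "S \<in> \<U> \<Longrightarrow> pow_rep S (set_alg S (Pow S)) (dec S)"
  by (intro pow_repI set_alg_rep algebra_Pow)

lemma set_alg_small:
  assumes "S \<in> \<U>" "\<A> \<subseteq> Pow S" shows "carrier (set_alg S \<A>) \<in> \<U>"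
  unfolding carrier_set_alg by (intro subset_closed[OF e_small[OF assms(1)]] image_mono assms(2))

lemma preim_e:
  assumes "T \<in> \<U>" "\<A> \<subseteq> Pow T" "V \<in> \<A>"
  shows "preim S T \<A> f (e T V) = e S (f -` V \<inter> S)"
  using assms dec_e[OF assms(1)] by (auto simp: preim_def)

lemma dec_preim:
  assumes "S \<in> \<U>" "a \<in> e T ` \<A>"
  shows "dec S (preim S T \<A> f a) = f -` dec T a \<inter> S"
  using assms by (simp add: preim_def dec_e)

lemma preim_funcset:
  assumes "T \<in> \<U>" "\<A> \<subseteq> Pow T" "\<And>V. V \<in> \<A> \<Longrightarrow> f -` V \<inter> S \<in> \<B>"
  shows "preim S T \<A> f \<in> e T ` \<A> \<rightarrow> e S ` \<B>"
  using assms preim_e[OF assms(1,2)] by auto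

lemma preim_id:
  assumes "S \<in> \<U>" "\<A> \<subseteq> Pow S"
  shows "preim S S \<A> (\<lambda>x\<in>S. x) = (\<lambda>a\<in>e S ` \<A>. a)"
proof
  fix a
  \<comment> \<open>Outside \<open>S\<close> the restricted identity has the value
    \<open>undefined\<close>, which may belong to \<open>V\<close>; the intersection with
    \<open>S\<close> discards such points.\<close>
  have *: "(\<lambda>x\<in>S. x) -` V \<inter> S = V" if "V \<in> \<A>" for V
  proof -
    have "V \<subseteq> S" using that assms by auto
    then show ?thesis by auto
  qed
  show "preim S S \<A> (\<lambda>x\<in>S. x) a = (\<lambda>a\<in>e S ` \<A>. a) a"
  proof (cases "a \<in> e S ` \<A>")
    case True
    then obtain V where V: "V \<in> \<A>" "a = e S V" by auto
    show ?thesis using True preim_e[OF assms V(1)] * [OF V(1)] V(2) by simp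
  qed (simp add: preim_def)
qed

lemma preim_compose:
  assumes "T \<in> \<U>" "R \<in> \<U>" "\<A> \<subseteq> Pow T" "\<B> \<subseteq> Pow R" "f \<in> S \<rightarrow> T"
    and "\<And>V. V \<in> \<B> \<Longrightarrow> g -` V \<inter> T \<in> \<A>"
  shows "preim S R \<B> (compose S g f) = compose (e R ` \<B>) (preim S T \<A> f) (preim T R \<B> g)"
proof
  fix a
  have *: "compose S g f -` V \<inter> S = f -` (g -` V \<inter> T) \<inter> S" for V
    using assms(5) by (auto simp: compose_eq)
  show "preim S R \<B> (compose S g f) a = compose (e R ` \<B>) (preim S T \<A> f) (preim T R \<B> g) a"
  proof (cases "a \<in> e R ` \<B>")
    case True
    then obtain V where V: "V \<in> \<B>" "a = e R V" by auto
    show ?thesis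
      using True preim_e[OF assms(2,4) V(1)] preim_e[OF assms(1,3) assms(6)[OF V(1)]]
      by (simp add: V(2) compose_eq *)
  qed (simp add: preim_def compose_def)
qed

lemma preim_eq_iff:
  assumes "S \<in> \<U>" "T \<in> \<U>" "\<A> \<subseteq> Pow T" "preim S T \<A> f = preim S T \<A> g" "V \<in> \<A>"
  shows "f -` V \<inter> S = g -` V \<inter> S"
proof -
  have V: "e T V \<in> e T ` \<A>" "dec T (e T V) = V"
    using assms(2,3,5) dec_e[of T V] by auto
  have "dec S (preim S T \<A> f (e T V)) = dec S (preim S T \<A> g (e T V))"
    using assms(4) by simp
  then show ?thesis by (simp only: dec_preim[OF assms(1) V(1)] V(2))
qed

lemma clopen_functor_obj:
  assumes K: "K \<in> objs (ZComp_cat \<U>)"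
  shows "fobj clopen_functor K \<in> objs (zMaps_cat \<U>)"
proof -
  let ?X = "topspace (src K)" and ?Y = "topspace (tgt K)" and ?\<C> = "clopens (tgt K)"
  let ?A = "set_alg ?Y ?\<C>" and ?B = "set_alg ?X (Pow ?X)" and ?\<alpha> = "preim ?X ?Y ?\<C> (cmap K)"
  have X: "?X \<in> \<U>" and Y: "?Y \<in> \<U>" and zd: "zero_dimensional_space (tgt K)"
    and hc: "hausdorff_compactification (src K) (tgt K) (cmap K)"
    using K by (auto simp: ZComp_objs)
  note c = hausdorff_compactification_funcset[OF hc]
  have \<C>: "?\<C> \<subseteq> Pow ?Y" using clopens_subset by auto
  interpret A: set_rep ?Y ?\<C> ?A "dec ?Y" by (intro set_alg_rep Y algebra_clopens)
  interpret B: pow_rep ?X ?B "dec ?X" by (intro set_alg_pow_rep X)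
  have \<alpha>_in: "?\<alpha> \<in> carrier ?A \<rightarrow> carrier ?B"
    unfolding carrier_set_alg by (rule preim_funcset[OF Y \<C>]) auto
  have dec_\<alpha>: "dec ?X (?\<alpha> a) = cmap K -` dec ?Y a \<inter> ?X" if "a \<in> carrier ?A" for a
    using dec_preim[OF X] that by (simp add: carrier_set_alg)
  have "boolean_z_map ?A ?B ?\<alpha>"
    unfolding boolean_z_map_def
  proof (intro conjI allI impI)
    show "boolean_alg ?A" by (rule A.boolean_alg)
    show "complete_atomic_boolean_alg ?B" by (rule B.complete_atomic_boolean_alg)
    show "boolean_hom ?A ?B ?\<alpha>"
      by (rule boolean_hom_preimage[OF A.set_rep_axioms B.set_rep_axioms \<alpha>_in c dec_\<alpha>])
    show "inj_on ?\<alpha> (carrier ?A)"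
    proof (rule inj_onI)
      fix a b assume ab: "a \<in> carrier ?A" "b \<in> carrier ?A" "?\<alpha> a = ?\<alpha> b"
      then have "cmap K -` dec ?Y a \<inter> ?X = cmap K -` dec ?Y b \<inter> ?X"
        using dec_\<alpha>[OF ab(1)] dec_\<alpha>[OF ab(2)] by simp
      then have same: "dec ?Y a \<inter> cmap K ` ?X = dec ?Y b \<inter> cmap K ` ?X" by blast
      have "tgt K closure_of (cmap K ` ?X) = ?Y"
        using hc by (simp add: hausdorff_compactification_def)
      from clopens_dense_eq[OF this A.r_in[OF ab(1)] A.r_in[OF ab(2)] same]
      have "dec ?Y a = dec ?Y b" .
      then show "a = b" by (rule A.r_inj[OF ab(1,2)])
    qed
    fix b assume b: "is_atom ?B b"
    then obtain p where p: "p \<in> ?X" "dec ?X b = {p}" using B.atom_singleton by blast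
    \<comment> \<open>The traces of all clopen sets around \<open>cmap K p\<close>. For
      \<open>q \<noteq> p\<close> in \<open>X\<close> the embedding keeps the images apart, and a
      clopen set separating them contributes a trace without \<open>q\<close>; so the meet of
      \<open>S\<close> is the atom of \<open>p\<close>.\<close>
    define S where "S = ?\<alpha> ` {a \<in> carrier ?A. cmap K p \<in> dec ?Y a}"
    have S: "S \<subseteq> carrier ?B" using \<alpha>_in by (auto simp: S_def)
    have "q = p" if q: "q \<in> ?X" "\<forall>s\<in>S. q \<in> dec ?X s" for q
    proof (rule ccontr)
      assume "q \<noteq> p"
      moreover have haus: "Hausdorff_space (tgt K)" using hc by (simp add: hausdorff_compactification_def)
      moreover have cp: "cmap K p \<in> ?Y" and cq: "cmap K q \<in> ?Y" using c p q by auto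
      moreover have "inj_on (cmap K) ?X"
        using hc homeomorphic_imp_injective_map[of "src K" _ "cmap K"]
        unfolding hausdorff_compactification_def embedding_map_def by blast
      ultimately have "cmap K p \<noteq> cmap K q" using p q by (auto dest: inj_onD)
      then obtain V where V: "V \<in> ?\<C>" "cmap K p \<in> V" "cmap K q \<notin> V"
        using clopens_separate[OF zd haus, of "cmap K p" "cmap K q"] cp cq by blast
      then obtain a where a: "a \<in> carrier ?A" "dec ?Y a = V" using A.r_surj by blast
      then have "?\<alpha> a \<in> S" using V by (simp add: S_def)
      then have "q \<in> dec ?X (?\<alpha> a)" using q by blast
      then show False using V a by (simp add: dec_\<alpha>)
    qed
    moreover have "p \<in> dec ?X s" if "s \<in> S" for s
    proof -
      obtain a where "a \<in> carrier ?A" "cmap K p \<in> dec ?Y a" "s = ?\<alpha> a" using \<open>s \<in> S\<close> by (auto simp: S_def)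
      then show ?thesis using p(1) dec_\<alpha>[of a] by simp
    qed
    ultimately have "?X \<inter> \<Inter>(dec ?X ` S) = {p}" using p(1) by blast
    then have "dec ?X (\<Sqinter>\<^bsub>?B\<^esub>S) = {p}" by (simp only: B.Inf(3)[OF S])
    then have "b = \<Sqinter>\<^bsub>?B\<^esub>S"
      using B.Inf(2)[OF S] b p by (intro B.r_inj) (simp_all add: is_atom_def)
    moreover have "S \<subseteq> ?\<alpha> ` carrier ?A" by (auto simp: S_def)
    ultimately show "\<exists>S. S \<subseteq> ?\<alpha> ` carrier ?A \<and> b = \<Sqinter>\<^bsub>?B\<^esub>S" by blast
  qed
  moreover have "?\<alpha> \<in> extensional (carrier ?A)" by (simp add: preim_def carrier_set_alg)
  ultimately show ?thesis
    using set_alg_small[OF X] set_alg_small[OF Y \<C>] by (simp add: zMaps_objs clopen_functor_def)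
qed

lemma clopen_functor_map:
  assumes K: "K \<in> objs (ZComp_cat \<U>)" and K': "K' \<in> objs (ZComp_cat \<U>)"
    and p: "p \<in> homs (ZComp_cat \<U>) K K'"
  shows "fmap clopen_functor K K' p \<in> homs (zMaps_cat \<U>) (fobj clopen_functor K') (fobj clopen_functor K)"
proof -
  obtain f g where fg: "p = (f, g)" by (metis surj_pair)
  let ?X = "topspace (src K)" and ?Y = "topspace (tgt K)" and ?\<C> = "clopens (tgt K)"
  let ?X' = "topspace (src K')" and ?Y' = "topspace (tgt K')" and ?\<C>' = "clopens (tgt K')"
  have sm: "?X \<in> \<U>" "?Y \<in> \<U>" "?X' \<in> \<U>" "?Y' \<in> \<U>"
    and hc: "hausdorff_compactification (src K) (tgt K) (cmap K)" "hausdorff_compactification (src K') (tgt K') (cmap K')"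
    using K K' by (auto simp: ZComp_objs)
  have f: "continuous_map (src K) (src K') f" and g: "continuous_map (tgt K) (tgt K') g"
    and gc: "\<forall>x\<in>?X. g (cmap K x) = cmap K' (f x)"
    using p by (auto simp: fg ZComp_homs)
  note c = hausdorff_compactification_funcset[OF hc(1)] hausdorff_compactification_funcset[OF hc(2)]
  have sub: "?\<C> \<subseteq> Pow ?Y" "?\<C>' \<subseteq> Pow ?Y'" using clopens_subset by auto
  have \<phi>: "preim ?Y ?Y' ?\<C>' g \<in> e ?Y' ` ?\<C>' \<rightarrow> e ?Y ` ?\<C>"
    by (rule preim_funcset[OF sm(4) sub(2) clopens_preimage[OF g]])
  have \<sigma>: "preim ?X ?X' (Pow ?X') f \<in> e ?X' ` Pow ?X' \<rightarrow> e ?X ` Pow ?X"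
    by (rule preim_funcset[OF sm(3)]) auto
  have "boolean_hom (set_alg ?Y' ?\<C>') (set_alg ?Y ?\<C>) (preim ?Y ?Y' ?\<C>' g)"
    by (rule boolean_hom_preimage[OF set_alg_rep[OF sm(4) algebra_clopens]
        set_alg_rep[OF sm(2) algebra_clopens] _ continuous_map_funspace[OF g]])
      (use \<phi> in \<open>auto simp: carrier_set_alg dec_preim[OF sm(2)]\<close>)
  moreover have "complete_boolean_hom (set_alg ?X' (Pow ?X')) (set_alg ?X (Pow ?X)) (preim ?X ?X' (Pow ?X') f)"
    by (rule complete_boolean_hom_preimage[OF set_alg_pow_rep[OF sm(3)] set_alg_pow_rep[OF sm(1)] _
          continuous_map_funspace[OF f]])
      (use \<sigma> in \<open>auto simp: carrier_set_alg dec_preim[OF sm(1)]\<close>)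
  moreover have "preim ?X ?Y ?\<C> (cmap K) (preim ?Y ?Y' ?\<C>' g a) =
      preim ?X ?X' (Pow ?X') f (preim ?X' ?Y' ?\<C>' (cmap K') a)" if a: "a \<in> e ?Y' ` ?\<C>'" for a
  proof -
    obtain V where V: "V \<in> ?\<C>'" "a = e ?Y' V" using a by auto
    have *: "cmap K' -` V \<inter> ?X' \<in> Pow ?X'" by auto
    \<comment> \<open>The square of maps, read on preimages of \<open>V\<close>, is the square of
      homomorphisms.\<close>
    have "cmap K -` (g -` V \<inter> ?Y) \<inter> ?X = f -` (cmap K' -` V \<inter> ?X') \<inter> ?X"
      using c continuous_map_funspace[OF f] gc by auto
    then show ?thesis
      unfolding V(2) preim_e[OF sm(4) sub(2) V(1)] preim_e[OF sm(2) sub(1) clopens_preimage[OF g V(1)]]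
        preim_e[OF sm(3) subset_refl *] by simp
  qed
  ultimately show ?thesis
    by (simp add: fg zMaps_homs clopen_functor_def carrier_set_alg) (simp add: preim_def)
qed

lemma contravariant_clopen_functor: "contravariant_functor (ZComp_cat \<U>) (zMaps_cat \<U>) clopen_functor"
  unfolding contravariant_functor_def
proof (intro conjI ballI)
  fix K assume K: "K \<in> objs (ZComp_cat \<U>)"
  then have "topspace (src K) \<in> \<U>" "topspace (tgt K) \<in> \<U>" by (auto simp: ZComp_objs)
  moreover have "clopens (tgt K) \<subseteq> Pow (topspace (tgt K))" using clopens_subset by auto
  ultimately show "fmap clopen_functor K K (ident (ZComp_cat \<U>) K) = ident (zMaps_cat \<U>) (fobj clopen_functor K)"
    by (simp add: ZComp_ident zMaps_ident clopen_functor_def carrier_set_alg preim_id)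
next
  fix K K' K'' p q
  assume K: "K \<in> objs (ZComp_cat \<U>)" "K' \<in> objs (ZComp_cat \<U>)" "K'' \<in> objs (ZComp_cat \<U>)"
    and p: "p \<in> homs (ZComp_cat \<U>) K K'" and q: "q \<in> homs (ZComp_cat \<U>) K' K''"
  obtain f g f' g' where eq: "p = (f, g)" "q = (f', g')" by (metis surj_pair)
  have sm: "topspace (src K') \<in> \<U>" "topspace (tgt K') \<in> \<U>" "topspace (src K'') \<in> \<U>" "topspace (tgt K'') \<in> \<U>"
    using K by (auto simp: ZComp_objs)
  have fg: "f \<in> topspace (src K) \<rightarrow> topspace (src K')" "g \<in> topspace (tgt K) \<rightarrow> topspace (tgt K')"
    and g': "continuous_map (tgt K') (tgt K'') g'"
    using p q continuous_map_funspace unfolding eq ZComp_homs by blast+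
  have sub: "clopens Y \<subseteq> Pow (topspace Y)" for Y :: "'u topology" using clopens_subset by auto
  show "fmap clopen_functor K K'' (compn (ZComp_cat \<U>) K K' K'' q p) =
      compn (zMaps_cat \<U>) (fobj clopen_functor K'') (fobj clopen_functor K') (fobj clopen_functor K)
        (fmap clopen_functor K K' p) (fmap clopen_functor K' K'' q)"
    using preim_compose[OF sm(2,4) sub sub fg(2) clopens_preimage[OF g']]
      preim_compose[OF sm(1,3) subset_refl subset_refl fg(1), of f']
    by (simp add: eq clopen_functor_def ZComp_compn zMaps_compn carrier_set_alg)
qed (fact clopen_functor_obj clopen_functor_map)+

text \<open>Preimages of singletons determine \<open>f\<close>, since all subsets of the source
  space are coded. For \<open>g\<close> only clopen sets are available, and their separation of
  points takes the place of singletons.\<close>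

lemma clopen_functor_faithful:
  assumes K: "K \<in> objs (ZComp_cat \<U>)" and K': "K' \<in> objs (ZComp_cat \<U>)"
  shows "inj_on (fmap clopen_functor K K') (homs (ZComp_cat \<U>) K K')"
proof (rule inj_onI)
  fix p q assume p: "p \<in> homs (ZComp_cat \<U>) K K'" and q: "q \<in> homs (ZComp_cat \<U>) K K'"
    and eq: "fmap clopen_functor K K' p = fmap clopen_functor K K' q"
  obtain f g f' g' where fg: "p = (f, g)" "q = (f', g')" by (metis surj_pair)
  let ?X = "topspace (src K)" and ?Y = "topspace (tgt K)"
  let ?X' = "topspace (src K')" and ?Y' = "topspace (tgt K')" and ?\<C>' = "clopens (tgt K')"
  have sm: "?X \<in> \<U>" "?Y \<in> \<U>" "?X' \<in> \<U>" "?Y' \<in> \<U>"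
    and K'_sep: "zero_dimensional_space (tgt K')" "Hausdorff_space (tgt K')"
    using K K' by (auto simp: ZComp_objs hausdorff_compactification_def)
  have fs: "f \<in> ?X \<rightarrow> ?X'" "f' \<in> ?X \<rightarrow> ?X'" "g \<in> ?Y \<rightarrow> ?Y'" "g' \<in> ?Y \<rightarrow> ?Y'"
    and ext: "f \<in> extensional ?X" "f' \<in> extensional ?X" "g \<in> extensional ?Y" "g' \<in> extensional ?Y"
    using p q continuous_map_funspace unfolding fg ZComp_homs by blast+
  have eqg: "preim ?Y ?Y' ?\<C>' g = preim ?Y ?Y' ?\<C>' g'"
    and eqf: "preim ?X ?X' (Pow ?X') f = preim ?X ?X' (Pow ?X') f'"
    using eq by (auto simp: fg clopen_functor_def)
  have "f = f'"
  proof (rule extensionalityI[OF ext(1,2)])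
    fix x assume x: "x \<in> ?X"
    have "{f x} \<in> Pow ?X'" using fs x by auto
    from preim_eq_iff[OF sm(1,3) subset_refl eqf this] have "x \<in> f' -` {f x} \<inter> ?X"
      using x by blast
    then show "f x = f' x" by simp
  qed
  moreover have "g = g'"
  proof (rule extensionalityI[OF ext(3,4)], rule ccontr)
    fix y assume y: "y \<in> ?Y" "g y \<noteq> g' y"
    then obtain V where V: "V \<in> ?\<C>'" "g y \<in> V" "g' y \<notin> V"
      using clopens_separate[OF K'_sep funcset_mem[OF fs(3) y(1)] funcset_mem[OF fs(4) y(1)] y(2)] by blast
    have "?\<C>' \<subseteq> Pow ?Y'" using clopens_subset by auto
    from preim_eq_iff[OF sm(2,4) this eqg V(1)] show False using V y by auto
  qed
  ultimately show "p = q" by (simp add: fg)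
qed

text \<open>The maps \<open>g\<close> and \<open>f\<close> are extracted from \<open>\<phi>\<close>
  and \<open>\<sigma>\<close> separately. The square between them and the continuity of
  \<open>f\<close> are not visible in either component alone; both come from the commutation of
  \<open>\<phi>\<close> and \<open>\<sigma>\<close> with the z-maps.\<close>

lemma clopen_functor_full:
  assumes K: "K \<in> objs (ZComp_cat \<U>)" and K': "K' \<in> objs (ZComp_cat \<U>)"
    and u: "u \<in> homs (zMaps_cat \<U>) (fobj clopen_functor K') (fobj clopen_functor K)"
  shows "\<exists>p\<in>homs (ZComp_cat \<U>) K K'. fmap clopen_functor K K' p = u"
proof -
  obtain \<phi> \<sigma> where fg: "u = (\<phi>, \<sigma>)" by (metis surj_pair)
  let ?X = "topspace (src K)" and ?Y = "topspace (tgt K)" and ?\<C> = "clopens (tgt K)"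
  let ?X' = "topspace (src K')" and ?Y' = "topspace (tgt K')" and ?\<C>' = "clopens (tgt K')"
  let ?A = "set_alg ?Y ?\<C>" and ?B = "set_alg ?X (Pow ?X)"
  let ?A' = "set_alg ?Y' ?\<C>'" and ?B' = "set_alg ?X' (Pow ?X')"
  have sm: "?X \<in> \<U>" "?Y \<in> \<U>" "?X' \<in> \<U>" "?Y' \<in> \<U>"
    and K'_sep: "zero_dimensional_space (tgt K')" "Hausdorff_space (tgt K')" "compact_space (tgt K')"
    and hc: "hausdorff_compactification (src K) (tgt K) (cmap K)" "hausdorff_compactification (src K') (tgt K') (cmap K')"
    using K K' by (auto simp: ZComp_objs hausdorff_compactification_def)
  note c = hausdorff_compactification_funcset[OF hc(1)] hausdorff_compactification_funcset[OF hc(2)]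
  have sub: "?\<C> \<subseteq> Pow ?Y" "?\<C>' \<subseteq> Pow ?Y'" using clopens_subset by auto
  interpret A: set_rep ?Y ?\<C> ?A "dec ?Y" by (intro set_alg_rep sm algebra_clopens)
  interpret A': set_rep ?Y' ?\<C>' ?A' "dec ?Y'" by (intro set_alg_rep sm algebra_clopens)
  interpret B: pow_rep ?X ?B "dec ?X" by (intro set_alg_pow_rep sm)
  interpret B': pow_rep ?X' ?B' "dec ?X'" by (intro set_alg_pow_rep sm)
  have ext: "\<phi> \<in> extensional (carrier ?A')" "\<sigma> \<in> extensional (carrier ?B')"
    and \<phi>: "boolean_hom ?A' ?A \<phi>" and \<sigma>: "complete_boolean_hom ?B' ?B \<sigma>"
    and comm: "\<And>a. a \<in> carrier ?A' \<Longrightarrow>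
      preim ?X ?Y ?\<C> (cmap K) (\<phi> a) = \<sigma> (preim ?X' ?Y' ?\<C>' (cmap K') a)"
    using u by (auto simp: fg zMaps_homs clopen_functor_def)
  have \<phi>_in: "\<phi> a \<in> carrier ?A" if "a \<in> carrier ?A'" for a using \<phi> that by (auto simp: boolean_hom_def)
  have \<sigma>_in: "\<sigma> a \<in> carrier ?B" if "a \<in> carrier ?B'" for a
    using \<sigma> that by (auto simp: complete_boolean_hom_def boolean_hom_def)
  have "closedin (tgt K') V" if "V \<in> ?\<C>'" for V using that by (simp add: clopens_def)
  from compact_hom_point_map[OF A'.set_rep_axioms A.set_rep_axioms \<phi> K'_sep(3) this]
  obtain g0 where g0: "g0 \<in> ?Y \<rightarrow> ?Y'" "\<And>a. a \<in> carrier ?A' \<Longrightarrow> dec ?Y (\<phi> a) = g0 -` dec ?Y' a \<inter> ?Y"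
    by blast
  obtain f0 where f0: "f0 \<in> ?X \<rightarrow> ?X'" "\<And>a. a \<in> carrier ?B' \<Longrightarrow> dec ?X (\<sigma> a) = f0 -` dec ?X' a \<inter> ?X"
    using complete_hom_point_map[OF B'.pow_rep_axioms B.pow_rep_axioms \<sigma>] by blast
  define f g where "f = restrict f0 ?X" and "g = restrict g0 ?Y"
  have f: "f \<in> ?X \<rightarrow> ?X'" "f \<in> extensional ?X"
    and dec_\<sigma>: "\<And>a. a \<in> carrier ?B' \<Longrightarrow> dec ?X (\<sigma> a) = f -` dec ?X' a \<inter> ?X"
    using f0 by (auto simp: f_def)
  have g: "g \<in> ?Y \<rightarrow> ?Y'" "g \<in> extensional ?Y"
    and dec_\<phi>: "\<And>a. a \<in> carrier ?A' \<Longrightarrow> dec ?Y (\<phi> a) = g -` dec ?Y' a \<inter> ?Y"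
    using g0 by (auto simp: g_def)
  have g_cont: "continuous_map (tgt K) (tgt K') g"
  proof (rule continuous_map_clopen_base[OF K'_sep(1) g(1)])
    fix V assume "V \<in> ?\<C>'"
    then obtain a where "a \<in> carrier ?A'" "dec ?Y' a = V" using A'.r_surj by blast
    then show "g -` V \<inter> ?Y \<in> ?\<C>" using dec_\<phi>[of a] A.r_in[OF \<phi>_in, of a] by simp
  qed
  \<comment> \<open>If the two points differed, a clopen \<open>V\<close> would contain only the
    first. Commutation of the homomorphisms at the code of \<open>V\<close> says that
    \<open>x\<close> lies in both resulting subsets of \<open>X\<close> or in neither, a
    contradiction.\<close>
  have gc: "g (cmap K x) = cmap K' (f x)" if x: "x \<in> ?X" for x
  proof (rule ccontr)
    assume "g (cmap K x) \<noteq> cmap K' (f x)"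
    moreover have cx: "cmap K x \<in> ?Y" "f x \<in> ?X'" "g (cmap K x) \<in> ?Y'" "cmap K' (f x) \<in> ?Y'"
      using x c f(1) g(1) by auto
    ultimately obtain V where V: "V \<in> ?\<C>'" "g (cmap K x) \<in> V" "cmap K' (f x) \<notin> V"
      using clopens_separate[OF K'_sep(1,2)] by metis
    then obtain a where a: "a \<in> carrier ?A'" "dec ?Y' a = V" using A'.r_surj by blast
    have \<alpha>'a: "preim ?X' ?Y' ?\<C>' (cmap K') a \<in> carrier ?B'"
      using preim_funcset[OF sm(4) sub(2), of "cmap K'" ?X' "Pow ?X'"] a by (auto simp: carrier_set_alg)
    have "x \<in> dec ?X (preim ?X ?Y ?\<C> (cmap K) (\<phi> a))"
      using dec_preim[OF sm(1), of "\<phi> a" ?Y ?\<C> "cmap K"] \<phi>_in[OF a(1)] dec_\<phi>[OF a(1)] a V x cx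
      by (auto simp: carrier_set_alg)
    moreover have "x \<notin> dec ?X (\<sigma> (preim ?X' ?Y' ?\<C>' (cmap K') a))"
      using dec_preim[OF sm(3), of a ?Y' ?\<C>' "cmap K'"] dec_\<sigma>[OF \<alpha>'a] a V
      by (auto simp: carrier_set_alg)
    ultimately show False using comm[OF a(1)] by simp
  qed
  \<comment> \<open>\<open>\<sigma>\<close> carries no topological information. By the square,
    \<open>f\<close> is \<open>cmap K\<close> followed by \<open>g\<close> and by the continuous
    inverse \<open>d\<close> of the embedding \<open>cmap K'\<close> on its image.\<close>
  have f_cont: "continuous_map (src K) (src K') f"
  proof -
    have emb: "embedding_map (src K') (tgt K') (cmap K')" using hc by (simp add: hausdorff_compactification_def)
    then obtain d where d: "homeomorphic_maps (src K') (subtopology (tgt K') (cmap K' ` ?X')) (cmap K') d"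
      by (auto simp: embedding_map_def homeomorphic_map_maps)
    have "continuous_map (src K) (tgt K) (cmap K)"
      by (rule hausdorff_compactification_continuous[OF hc(1)])
    then have "continuous_map (src K) (tgt K') (g \<circ> cmap K)"
      using g_cont by (rule continuous_map_compose)
    then have "continuous_map (src K) (subtopology (tgt K') (cmap K' ` ?X')) (g \<circ> cmap K)"
      using gc f(1) by (auto simp: continuous_map_in_subtopology)
    then have "continuous_map (src K) (src K') (d \<circ> (g \<circ> cmap K))"
      using d continuous_map_compose unfolding homeomorphic_maps_def by blast
    then show ?thesis
      by (rule continuous_map_eq) (use d gc f(1) in \<open>auto simp: homeomorphic_maps_def\<close>)
  qed
  have "preim ?Y ?Y' ?\<C>' g = \<phi>"
  proof (rule extensionalityI[OF _ ext(1)])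
    show "preim ?Y ?Y' ?\<C>' g \<in> extensional (carrier ?A')" by (simp add: preim_def carrier_set_alg)
    fix a assume a: "a \<in> carrier ?A'"
    have "preim ?Y ?Y' ?\<C>' g a \<in> carrier ?A"
      using preim_funcset[OF sm(4) sub(2) clopens_preimage[OF g_cont]] a by (auto simp: carrier_set_alg)
    then show "preim ?Y ?Y' ?\<C>' g a = \<phi> a"
      using \<phi>_in[OF a] dec_\<phi>[OF a] dec_preim[OF sm(2)] a by (intro A.r_inj) (auto simp: carrier_set_alg)
  qed
  moreover have "preim ?X ?X' (Pow ?X') f = \<sigma>"
  proof (rule extensionalityI[OF _ ext(2)])
    show "preim ?X ?X' (Pow ?X') f \<in> extensional (carrier ?B')" by (simp add: preim_def carrier_set_alg)
    fix a assume a: "a \<in> carrier ?B'"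
    have "preim ?X ?X' (Pow ?X') f a \<in> carrier ?B"
      using preim_funcset[OF sm(3) subset_refl, of f ?X "Pow ?X"] a by (auto simp: carrier_set_alg)
    then show "preim ?X ?X' (Pow ?X') f a = \<sigma> a"
      using \<sigma>_in[OF a] dec_\<sigma>[OF a] dec_preim[OF sm(1)] a by (intro B.r_inj) (auto simp: carrier_set_alg)
  qed
  moreover have "(f, g) \<in> homs (ZComp_cat \<U>) K K'"
    using f g f_cont g_cont gc by (simp add: ZComp_homs)
  ultimately show ?thesis
    by (intro bexI[of _ "(f, g)"]) (simp_all add: fg clopen_functor_def)
qed

end

section \<open>Stone spaces of fields of sets\<close>

lemma zero_dimensional_spaceI:
  assumes "\<And>U p. openin Y U \<Longrightarrow> p \<in> U \<Longrightarrow> \<exists>V\<in>clopens Y. p \<in> V \<and> V \<subseteq> U"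
  shows "zero_dimensional_space Y"
  unfolding zero_dimensional_space_def
proof (intro exI[of _ "clopens Y"] conjI ext iffI)
  show "\<forall>U\<in>clopens Y. openin Y U \<and> closedin Y U" by (simp add: clopens_def)
  fix U
  show "(arbitrary union_of (\<lambda>U. U \<in> clopens Y)) U" if "openin Y U"
    unfolding union_of_def arbitrary_def
  proof (intro exI[of _ "{V \<in> clopens Y. V \<subseteq> U}"] conjI)
    show "\<Union>{V \<in> clopens Y. V \<subseteq> U} = U" using assms[OF that] by blast
  qed auto
  show "openin Y U" if "(arbitrary union_of (\<lambda>U. U \<in> clopens Y)) U"
    using that by (auto simp: union_of_def arbitrary_def clopens_def intro!: openin_Union)
qed

text \<open>The pullback topology is the only one on \<open>X\<close> for which the injective
  \<open>c\<close> can be an embedding. It serves both to move a space along an injection and to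
  topologize the ground set of a field of sets.\<close>

lemma embedding_map_pullback_topology:
  assumes c: "c \<in> X \<rightarrow> topspace Y" "inj_on c X"
  shows "topspace (pullback_topology X c Y) = X" "embedding_map (pullback_topology X c Y) Y c"
proof -
  let ?T = "pullback_topology X c Y"
  show top: "topspace ?T = X" using c by (auto simp: topspace_pullback_topology)
  have "continuous_map ?T Y (id \<circ> c)" by (intro continuous_map_pullback continuous_map_id)
  then have "continuous_map ?T (subtopology Y (c ` X)) c"
    using top by (auto simp: continuous_map_in_subtopology)
  moreover have "continuous_map (subtopology Y (c ` X)) ?T (inv_into X c)"
  proof (rule continuous_map_pullback')
    have "continuous_map (subtopology Y (c ` X)) Y id" by (simp add: continuous_map_from_subtopology)
    then show "continuous_map (subtopology Y (c ` X)) Y (c \<circ> inv_into X c)"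
      by (rule continuous_map_eq) (auto simp: f_inv_into_f)
  qed (auto intro: inv_into_into)
  ultimately show "embedding_map ?T Y c"
    unfolding embedding_map_def homeomorphic_map_maps
    using c top by (intro exI[of _ "inv_into X c"]) (auto simp: homeomorphic_maps_def f_inv_into_f)
qed

text \<open>Pulling back needs a map into \<open>Y\<close>, whereas \<open>k\<close> leads out of
  it; so the image of \<open>k\<close> gets the topology pulled back along the inverse of
  \<open>k\<close>.\<close>

lemma homeomorphic_copy:
  assumes "inj_on k (topspace Y)"
  shows "\<exists>Y'. homeomorphic_map Y Y' k"
proof -
  let ?j = "inv_into (topspace Y) k"
  let ?Y' = "pullback_topology (k ` topspace Y) ?j Y"
  have j: "?j \<in> k ` topspace Y \<rightarrow> topspace Y" "inj_on ?j (k ` topspace Y)"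
    by (auto intro: inv_into_into inj_on_inv_into)
  note top = embedding_map_pullback_topology(1)[OF j]
  have "?j ` topspace ?Y' = topspace Y"
    unfolding top using assms by (simp add: inv_into_image_cancel)
  then have "homeomorphic_map ?Y' Y ?j"
    using embedding_map_pullback_topology(2)[OF j] surjective_embedding_map by blast
  then obtain i where i: "homeomorphic_maps ?Y' Y ?j i" by (auto simp: homeomorphic_map_maps)
  then have "homeomorphic_map Y ?Y' i"
    by (simp add: homeomorphic_maps_map)
  moreover have "i y = k y" if y: "y \<in> topspace Y" for y
  proof -
    have "i (?j (k y)) = k y" using i y top unfolding homeomorphic_maps_def by blast
    then show ?thesis using y assms by simp
  qed
  ultimately show ?thesis using homeomorphic_map_eq by blast
qed

lemma homeomorphic_map_clopens:
  assumes "homeomorphic_map Y Y' k"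
  shows "clopens Y' = (`) k ` clopens Y"
proof (intro equalityI subsetI)
  fix W assume W: "W \<in> clopens Y'"
  then have "W \<subseteq> k ` topspace Y"
    using homeomorphic_imp_surjective_map[OF assms] clopens_subset by blast
  then have "k ` (k -` W \<inter> topspace Y) = W" by auto
  moreover have "k -` W \<inter> topspace Y \<in> clopens Y"
    by (rule clopens_preimage[OF homeomorphic_imp_continuous_map[OF assms] W])
  ultimately show "W \<in> (`) k ` clopens Y" by (metis imageI)
next
  fix W assume "W \<in> (`) k ` clopens Y"
  then obtain V where "V \<in> clopens Y" "W = k ` V" by auto
  then show "W \<in> clopens Y'"
    using homeomorphic_map_openness[OF assms, of V] homeomorphic_map_closedness[OF assms, of V]
      clopens_subset[of V Y] by (simp add: clopens_def)
qed

lemma zero_dimensional_space_homeomorphic_map: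
  assumes "homeomorphic_map Y Y' k" "zero_dimensional_space Y"
  shows "zero_dimensional_space Y'"
proof (rule zero_dimensional_spaceI)
  fix U p assume U: "openin Y' U" "p \<in> U"
  then have "p \<in> k ` topspace Y"
    using homeomorphic_imp_surjective_map[OF assms(1)] openin_subset by blast
  then obtain q where q: "q \<in> topspace Y" "p = k q" by auto
  have "openin Y {y \<in> topspace Y. k y \<in> U}"
    using openin_continuous_map_preimage homeomorphic_imp_continuous_map assms(1) U(1) by blast
  then obtain V where V: "V \<in> clopens Y" "q \<in> V" "V \<subseteq> {y \<in> topspace Y. k y \<in> U}"
    using zero_dimensional_clopen_base[OF assms(2), of _ q] q U(2) by blast
  then show "\<exists>V\<in>clopens Y'. p \<in> V \<and> V \<subseteq> U"
    unfolding homeomorphic_map_clopens[OF assms(1)] using q by (intro bexI[of _ "k ` V"]) auto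
qed

text \<open>The points of \<open>Y\<close> are characteristic functions of ultrafilters on \<open>\<A>\<close>. Taking the closure of the
  principal ones in a power of the two-point space gives compactness and density for free, and makes
  the ultrafilter theorem superfluous.\<close>

lemma stone_space:
  assumes "algebra X \<A>"
  shows "\<exists>(Y :: ('x set \<Rightarrow> bool) topology) c. topspace Y \<subseteq> \<A> \<rightarrow>\<^sub>E UNIV \<and> compact_space Y \<and>
    Hausdorff_space Y \<and> zero_dimensional_space Y \<and> c \<in> X \<rightarrow> topspace Y \<and>
    Y closure_of (c ` X) = topspace Y \<and> (\<lambda>V. c -` V \<inter> X) ` clopens Y = \<A>"
proof -
  interpret algebra X \<A> by fact
  define P where "P = product_topology (\<lambda>_. discrete_topology (UNIV :: bool set)) \<A>"
  define c where "c x = (\<lambda>U\<in>\<A>. x \<in> U)" for x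
  define S where "S = P closure_of (c ` X)"
  define Y where "Y = subtopology P S"
  \<comment> \<open>In Stone's picture, the ultrafilters that contain \<open>U\<close>.\<close>
  define hat where "hat U = {p \<in> S. p U}" for U
  have topP: "topspace P = \<A> \<rightarrow>\<^sub>E UNIV" by (simp add: P_def)
  have S_sub: "S \<subseteq> topspace P" unfolding S_def by (rule closure_of_subset_topspace)
  then have topY: "topspace Y = S" by (auto simp: Y_def)
  have cX: "c ` X \<subseteq> S"
    unfolding S_def by (rule closure_of_subset) (auto simp: topP c_def)
  have "compact_space P"
    unfolding P_def by (simp add: compact_space_product_topology compact_space_discrete_topology)
  then have compY: "compact_space Y"
    unfolding Y_def S_def by (intro compact_space_subtopology closedin_compact_space) auto
  have hausY: "Hausdorff_space Y"
    unfolding Y_def P_def by (intro Hausdorff_space_subtopology) (simp add: Hausdorff_space_product_topology)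
  have dense: "Y closure_of (c ` X) = topspace Y"
    unfolding topY using cX by (auto simp: Y_def closure_of_subtopology S_def Int_absorb1)
  have hat_clopen: "hat U \<in> clopens Y" if "U \<in> \<A>" for U
  proof -
    have "continuous_map Y (discrete_topology UNIV) (\<lambda>p. p U)"
      unfolding Y_def P_def by (intro continuous_map_from_subtopology continuous_map_product_projection that)
    then have "(\<lambda>p. p U) -` {True} \<inter> topspace Y \<in> clopens Y"
      by (rule clopens_preimage) (simp add: clopens_def)
    moreover have "(\<lambda>p. p U) -` {True} \<inter> topspace Y = hat U" by (auto simp: hat_def topY)
    ultimately show ?thesis by simp
  qed
  have hat_trace: "hat U \<inter> c ` X = c ` U" if "U \<in> \<A>" for U
    using that sets_into_space[OF that] cX by (auto simp: hat_def c_def)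
  have c_hat: "c -` hat U \<inter> X = U" if "U \<in> \<A>" for U
    using that sets_into_space[OF that] cX by (auto simp: hat_def c_def)
  interpret Y: algebra "topspace Y" "clopens Y" by (rule algebra_clopens)
  have hat_eqI: "hat U = V" if "U \<in> \<A>" "V \<in> clopens Y" "\<And>x. x \<in> X \<Longrightarrow> c x \<in> V \<longleftrightarrow> x \<in> U" for U V
  proof (rule clopens_dense_eq[OF dense hat_clopen[OF that(1)] that(2)])
    show "hat U \<inter> c ` X = V \<inter> c ` X"
      using hat_trace[OF that(1)] that(3) sets_into_space[OF that(1)] by auto
  qed
  have hat_mem: "c x \<in> hat U \<longleftrightarrow> x \<in> U" if "U \<in> \<A>" "x \<in> X" for x U
    using that cX by (auto simp: hat_def c_def)
  have hat_Int: "hat (U \<inter> V) = hat U \<inter> hat V" if "U \<in> \<A>" "V \<in> \<A>" for U V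
    using that hat_mem by (intro hat_eqI Y.Int hat_clopen Int) auto
  have hat_Un: "hat (U \<union> V) = hat U \<union> hat V" if "U \<in> \<A>" "V \<in> \<A>" for U V
    using that hat_mem by (intro hat_eqI Y.Un hat_clopen Un) auto
  have hat_compl: "hat (X - U) = topspace Y - hat U" if "U \<in> \<A>" for U
    using that hat_mem cX topY by (intro hat_eqI Y.compl_sets hat_clopen compl_sets) auto
  have hat_top: "hat X = topspace Y"
    using cX topY by (intro hat_eqI Y.top top) auto
  have hat_bot: "hat {} = {}"
    by (intro hat_eqI) auto
  \<comment> \<open>Agreement with \<open>p\<close> in finitely many coordinates can be enforced by
    one member of \<open>\<A>\<close>. So the sets \<open>hat U\<close> are not merely a subbase but
    a base.\<close>
  have nbhd: "\<exists>U\<in>\<A>. p \<in> hat U \<and> (\<forall>q\<in>hat U. \<forall>V\<in>J. q V = p V)"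
    if "finite J" "J \<subseteq> \<A>" "p \<in> S" for J p
    using that
  proof (induction J)
    case empty
    then show ?case using hat_top topY by (intro bexI[of _ X]) auto
  next
    case (insert V J)
    then obtain U where U: "U \<in> \<A>" "p \<in> hat U" "\<forall>q\<in>hat U. \<forall>V\<in>J. q V = p V" by blast
    have V: "V \<in> \<A>" using insert by auto
    \<comment> \<open>Fixing the coordinate \<open>V\<close> at its value in \<open>p\<close> means
      lying in \<open>hat V\<close> or in the hat of the complement of \<open>V\<close>.\<close>
    define W where "W = (if p V then V else X - V)"
    have W: "W \<in> \<A>" using V by (auto simp: W_def)
    have hatW: "hat W = {q \<in> S. q V = p V}"
    proof (cases "p V")
      case True
      then show ?thesis by (simp add: W_def hat_def)
    next
      case False
      then have "hat W = S - hat V" using hat_compl[OF V] by (simp add: W_def topY)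
      also have "\<dots> = {q \<in> S. q V = p V}" using False by (auto simp: hat_def)
      finally show ?thesis .
    qed
    have pW: "p \<in> hat W" and Wp: "\<forall>q\<in>hat W. q V = p V"
      unfolding hatW using insert.prems(2) by blast+
    have "p \<in> hat (U \<inter> W)" "\<forall>q\<in>hat (U \<inter> W). \<forall>V'\<in>insert V J. q V' = p V'"
      unfolding hat_Int[OF U(1) W] using U(2,3) pW Wp by blast+
    then show ?case using Int[OF U(1) W] by blast
  qed
  have base: "\<exists>U\<in>\<A>. p \<in> hat U \<and> hat U \<subseteq> O'" if O': "openin Y O'" "p \<in> O'" for O' p
  proof -
    obtain Q where Q: "openin P Q" "O' = Q \<inter> S"
      using O'(1) by (auto simp: Y_def openin_subtopology)
    have pQ: "p \<in> Q" and pS: "p \<in> S" using O' Q by auto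
    obtain G where G: "finite {V \<in> \<A>. G V \<noteq> (UNIV :: bool set)}" "p \<in> Pi\<^sub>E \<A> G" "Pi\<^sub>E \<A> G \<subseteq> Q"
      using bspec[OF Q(1)[unfolded P_def openin_product_topology_alt] pQ] by auto
    obtain U where U: "U \<in> \<A>" "p \<in> hat U" "\<forall>q\<in>hat U. \<forall>V\<in>{V \<in> \<A>. G V \<noteq> UNIV}. q V = p V"
      using nbhd[OF G(1) _ pS] by blast
    have "q \<in> Pi\<^sub>E \<A> G" if q: "q \<in> hat U" for q
    proof (rule PiE_I)
      fix V assume V: "V \<in> \<A>"
      show "q V \<in> G V"
      proof (cases "G V = UNIV")
        case False
        then have "q V = p V" using U(3) q V by blast
        then show ?thesis using G(2) V by (simp only: PiE_mem)
      qed simp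
    next
      fix V assume "V \<notin> \<A>"
      moreover have "q \<in> \<A> \<rightarrow>\<^sub>E UNIV" using q S_sub topP by (auto simp: hat_def)
      ultimately show "q V = undefined" by (rule PiE_arb[rotated])
    qed
    moreover have "hat U \<subseteq> S" by (auto simp: hat_def)
    ultimately have "hat U \<subseteq> O'" using G(3) Q(2) by blast
    then show ?thesis using U(1,2) by blast
  qed
  have zdY: "zero_dimensional_space Y"
    using base hat_clopen by (intro zero_dimensional_spaceI) blast
  have hat_Union: "\<exists>U\<in>\<A>. hat U = \<Union>(hat ` \<F>)" if "finite \<F>" "\<F> \<subseteq> \<A>" for \<F>
    using that
  proof (induction \<F>)
    case empty
    then show ?case using hat_bot by auto
  next
    case (insert V \<F>)
    then obtain U where "U \<in> \<A>" "hat U = \<Union>(hat ` \<F>)" by auto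
    then show ?case using insert.prems hat_Un[of V U] by (intro bexI[of _ "V \<union> U"]) auto
  qed
  \<comment> \<open>A clopen set is compact and a union of hats, hence a finite union of them, which
    is again a hat. This excludes clopen sets beyond those coming from \<open>\<A>\<close>.\<close>
  have clopen_hat: "\<exists>U\<in>\<A>. hat U = C" if C: "C \<in> clopens Y" for C
  proof -
    let ?\<G> = "{U \<in> \<A>. hat U \<subseteq> C}"
    have "compactin Y C" using C compY by (auto simp: clopens_def intro: closedin_compact_space)
    moreover have "C \<subseteq> \<Union>(hat ` ?\<G>)" using base[of C] C by (auto simp: clopens_def)
    moreover have "\<forall>W\<in>hat ` ?\<G>. openin Y W" using hat_clopen by (auto simp: clopens_def)
    ultimately obtain \<H> where \<H>: "finite \<H>" "\<H> \<subseteq> hat ` ?\<G>" "C \<subseteq> \<Union>\<H>"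
      unfolding compactin_def by meson
    then obtain \<F> where \<F>: "finite \<F>" "\<F> \<subseteq> ?\<G>" "\<H> = hat ` \<F>" by (meson finite_subset_image)
    then obtain U where "U \<in> \<A>" "hat U = \<Union>(hat ` \<F>)" using hat_Union[of \<F>] by auto
    moreover have "\<Union>(hat ` \<F>) = C" using \<H>(3) \<F> by blast
    ultimately show ?thesis by auto
  qed
  have traces: "(\<lambda>V. c -` V \<inter> X) ` clopens Y = \<A>"
  proof (intro equalityI subsetI)
    fix U assume "U \<in> (\<lambda>V. c -` V \<inter> X) ` clopens Y"
    then obtain C where "C \<in> clopens Y" "U = c -` C \<inter> X" by blast
    moreover obtain V where "V \<in> \<A>" "hat V = C" using clopen_hat[OF \<open>C \<in> clopens Y\<close>] by blast
    ultimately show "U \<in> \<A>" using c_hat[of V] by simp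
  next
    fix U assume "U \<in> \<A>"
    then show "U \<in> (\<lambda>V. c -` V \<inter> X) ` clopens Y"
      using hat_clopen c_hat by (intro image_eqI[of _ _ "hat U"]) auto
  qed
  have "topspace Y \<subseteq> \<A> \<rightarrow>\<^sub>E UNIV" "c \<in> X \<rightarrow> topspace Y"
    using S_sub cX by (auto simp only: topY topP image_subset_iff_funcset)
  then show ?thesis
    using compY hausY zdY dense traces by (intro exI[of _ Y] exI[of _ c] conjI)
qed

text \<open>The points of the Stone space are functions on \<open>\<A>\<close>; the injection
  \<open>k\<close> renames them so that the space lives over a prescribed type. \<open>X\<close>
  receives the topology for which the canonical map is an embedding.\<close>

lemma stone_compactification:
  fixes \<A> :: "'x set set" and k :: "('x set \<Rightarrow> bool) \<Rightarrow> 'y"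
  assumes "algebra X \<A>" and sep: "\<And>p q. p \<in> X \<Longrightarrow> q \<in> X \<Longrightarrow> p \<noteq> q \<Longrightarrow> \<exists>U\<in>\<A>. p \<in> U \<and> q \<notin> U"
    and k: "inj_on k (\<A> \<rightarrow>\<^sub>E UNIV)"
  shows "\<exists>T Y c. topspace T = X \<and> topspace Y \<subseteq> k ` (\<A> \<rightarrow>\<^sub>E UNIV) \<and> c \<in> extensional X \<and>
    hausdorff_compactification T Y c \<and> zero_dimensional_space Y \<and> (\<lambda>V. c -` V \<inter> X) ` clopens Y = \<A>"
proof -
  obtain Y0 :: "('x set \<Rightarrow> bool) topology" and c0 where
    Y0: "topspace Y0 \<subseteq> \<A> \<rightarrow>\<^sub>E UNIV" "compact_space Y0" "Hausdorff_space Y0" "zero_dimensional_space Y0"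
    and c0: "c0 \<in> X \<rightarrow> topspace Y0" "Y0 closure_of (c0 ` X) = topspace Y0"
      "(\<lambda>V. c0 -` V \<inter> X) ` clopens Y0 = \<A>"
    using stone_space[OF assms(1)] by blast
  have kinj: "inj_on k (topspace Y0)" using k Y0(1) by (rule inj_on_subset)
  then obtain Y where Y: "homeomorphic_map Y0 Y k" using homeomorphic_copy by blast
  have topY: "topspace Y = k ` topspace Y0" using homeomorphic_imp_surjective_map[OF Y] by simp
  have hs: "Y0 homeomorphic_space Y" using Y homeomorphic_space by blast
  define c where "c = restrict (k \<circ> c0) X"
  have c: "c \<in> X \<rightarrow> topspace Y" using c0(1) topY by (auto simp: c_def)
  have "c ` X = k ` c0 ` X" by (auto simp: c_def)
  moreover have "c0 ` X \<subseteq> topspace Y0" using c0(1) by auto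
  ultimately have dense: "Y closure_of (c ` X) = topspace Y"
    using homeomorphic_map_closure_of[OF Y] c0(2) topY by simp
  have pre: "c -` (k ` V) \<inter> X = c0 -` V \<inter> X" if "V \<in> clopens Y0" for V
  proof -
    have "k (c0 x) \<in> k ` V \<longleftrightarrow> c0 x \<in> V" if "x \<in> X" for x
      using c0(1) that \<open>V \<in> clopens Y0\<close>
      by (intro inj_on_image_mem_iff[OF kinj] clopens_subset) auto
    then have "x \<in> c -` (k ` V) \<inter> X \<longleftrightarrow> x \<in> c0 -` V \<inter> X" for x
      by (cases "x \<in> X") (simp_all add: c_def)
    then show ?thesis by blast
  qed
  have traces: "(\<lambda>V. c -` V \<inter> X) ` clopens Y = \<A>"
    unfolding homeomorphic_map_clopens[OF Y] image_image c0(3)[symmetric]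
    by (rule image_cong[OF refl pre])
  \<comment> \<open>The traces of clopen sets are exactly \<open>\<A>\<close>, so two points with
    the same image would lie in the same members of \<open>\<A>\<close>.\<close>
  have cinj: "inj_on c X"
  proof (rule inj_onI, rule ccontr)
    fix p q assume pq: "p \<in> X" "q \<in> X" "c p = c q" "p \<noteq> q"
    then obtain U where U: "U \<in> \<A>" "p \<in> U" "q \<notin> U" using sep by blast
    then obtain V where "U = c -` V \<inter> X" using traces by blast
    then show False using U pq by auto
  qed
  let ?T = "pullback_topology X c Y"
  show ?thesis
  proof (intro exI[of _ ?T] exI[of _ Y] exI[of _ c] conjI traces)
    show top: "topspace ?T = X" by (rule embedding_map_pullback_topology(1)[OF c cinj])
    show "topspace Y \<subseteq> k ` (\<A> \<rightarrow>\<^sub>E UNIV)" unfolding topY using Y0(1) by (rule image_mono)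
    show "c \<in> extensional X" by (simp add: c_def)
    show "zero_dimensional_space Y" by (rule zero_dimensional_space_homeomorphic_map[OF Y Y0(4)])
    show "hausdorff_compactification ?T Y c"
      unfolding hausdorff_compactification_def top
      using embedding_map_pullback_topology(2)[OF c cinj] dense Y0(2,3)
        homeomorphic_compact_space[OF hs] homeomorphic_Hausdorff_space[OF hs] by simp
  qed
qed

section \<open>Comparing z-maps through the fields of sets they represent\<close>

lemma boolean_z_map_rep:
  assumes "boolean_z_map A B \<alpha>" "pow_rep X B r"
  shows "set_rep X ((r \<circ> \<alpha>) ` carrier A) A (r \<circ> \<alpha>)"
  by (rule subalgebra_rep[of X "Pow X" B]) (use assms in \<open>simp_all add: pow_rep_def boolean_z_map_def\<close>)

lemma zMaps_hom_carrier:
  assumes "(\<phi>, \<sigma>) \<in> homs (zMaps_cat \<U>) Z Z'"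
  shows "x \<in> carrier (dalg Z) \<Longrightarrow> \<phi> x \<in> carrier (dalg Z')"
    "y \<in> carrier (calg Z) \<Longrightarrow> \<sigma> y \<in> carrier (calg Z')"
  using assms by (auto simp: zMaps_homs boolean_hom_def complete_boolean_hom_def)

text \<open>Up to the representations, both z-maps are the inclusion of one and the same field into
  the power set of \<open>X\<close>. The arrow sends an element to the one representing the same
  set.\<close>

lemma zMaps_hom_of_same_rep:
  assumes Z: "Z \<in> objs (zMaps_cat \<U>)" and Z': "Z' \<in> objs (zMaps_cat \<U>)"
    and s: "pow_rep X (calg Z) s" and s': "pow_rep X (calg Z') s'"
    and same: "(s \<circ> amap Z) ` carrier (dalg Z) = (s' \<circ> amap Z') ` carrier (dalg Z')"
  shows "\<exists>\<phi> \<sigma>. (\<phi>, \<sigma>) \<in> homs (zMaps_cat \<U>) Z Z' \<and>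
    (\<forall>x\<in>carrier (dalg Z). s' (amap Z' (\<phi> x)) = s (amap Z x)) \<and>
    (\<forall>y\<in>carrier (calg Z). s' (\<sigma> y) = s y)"
proof -
  interpret B: pow_rep X "calg Z" s by fact
  interpret B': pow_rep X "calg Z'" s' by fact
  have zm: "boolean_z_map (dalg Z) (calg Z) (amap Z)" "boolean_z_map (dalg Z') (calg Z') (amap Z')"
    using Z Z' by (simp_all add: zMaps_objs)
  have \<alpha>: "amap Z x \<in> carrier (calg Z)" if "x \<in> carrier (dalg Z)" for x
    using zm(1) that by (auto simp: boolean_z_map_def boolean_hom_def)
  have \<alpha>': "amap Z' x \<in> carrier (calg Z')" if "x \<in> carrier (dalg Z')" for x
    using zm(2) that by (auto simp: boolean_z_map_def boolean_hom_def)
  have A: "set_rep X ((s \<circ> amap Z) ` carrier (dalg Z)) (dalg Z) (s \<circ> amap Z)"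
    and A': "set_rep X ((s' \<circ> amap Z') ` carrier (dalg Z')) (dalg Z') (s' \<circ> amap Z')"
    by (rule boolean_z_map_rep[OF zm(1) s], rule boolean_z_map_rep[OF zm(2) s'])
  have "\<forall>x\<in>carrier (dalg Z). \<exists>x'. x' \<in> carrier (dalg Z') \<and> s' (amap Z' x') = s (amap Z x)"
  proof
    fix x assume "x \<in> carrier (dalg Z)"
    then have "(s \<circ> amap Z) x \<in> (s' \<circ> amap Z') ` carrier (dalg Z')" unfolding same[symmetric] by (rule imageI)
    then show "\<exists>x'. x' \<in> carrier (dalg Z') \<and> s' (amap Z' x') = s (amap Z x)" by auto
  qed
  from bchoice[OF this] obtain \<phi>0 where
    \<phi>0: "\<forall>x\<in>carrier (dalg Z). \<phi>0 x \<in> carrier (dalg Z') \<and> s' (amap Z' (\<phi>0 x)) = s (amap Z x)" by blast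
  have "\<forall>y\<in>carrier (calg Z). \<exists>y'. y' \<in> carrier (calg Z') \<and> s' y' = s y"
  proof
    fix y assume "y \<in> carrier (calg Z)"
    then show "\<exists>y'. y' \<in> carrier (calg Z') \<and> s' y' = s y"
      using B'.r_surj[OF B.r_in] by blast
  qed
  from bchoice[OF this] obtain \<sigma>0 where
    \<sigma>0: "\<forall>y\<in>carrier (calg Z). \<sigma>0 y \<in> carrier (calg Z') \<and> s' (\<sigma>0 y) = s y" by blast
  define \<phi> \<sigma> where "\<phi> = restrict \<phi>0 (carrier (dalg Z))" and "\<sigma> = restrict \<sigma>0 (carrier (calg Z))"
  have \<phi>: "\<phi> x \<in> carrier (dalg Z')" "s' (amap Z' (\<phi> x)) = s (amap Z x)" if "x \<in> carrier (dalg Z)" for x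
    using \<phi>0 that by (simp_all add: \<phi>_def)
  have \<sigma>: "\<sigma> y \<in> carrier (calg Z')" "s' (\<sigma> y) = s y" if "y \<in> carrier (calg Z)" for y
    using \<sigma>0 that by (simp_all add: \<sigma>_def)
  \<comment> \<open>Keeping the represented set means taking preimages under the identity of
    \<open>X\<close>, so the general criterion for homomorphisms applies.\<close>
  have id: "(\<lambda>x. x) \<in> X \<rightarrow> X" by simp
  have "boolean_hom (dalg Z) (dalg Z') \<phi>"
  proof (rule boolean_hom_preimage[OF A A' _ id])
    fix x assume x: "x \<in> carrier (dalg Z)"
    show "(s' \<circ> amap Z') (\<phi> x) = (\<lambda>x. x) -` (s \<circ> amap Z) x \<inter> X"
      using \<phi>(2)[OF x] B.r_sub[OF \<alpha>[OF x]] by auto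
  qed (use \<phi> in auto)
  moreover have "complete_boolean_hom (calg Z) (calg Z') \<sigma>"
  proof (rule complete_boolean_hom_preimage[OF s s' _ id])
    fix y assume y: "y \<in> carrier (calg Z)"
    show "s' (\<sigma> y) = (\<lambda>x. x) -` s y \<inter> X"
      using \<sigma>(2)[OF y] B.r_sub[OF y] by auto
  qed (use \<sigma> in auto)
  moreover have "amap Z' (\<phi> x) = \<sigma> (amap Z x)" if x: "x \<in> carrier (dalg Z)" for x
    using \<phi>[OF x] \<sigma>[OF \<alpha>[OF x]] \<alpha>' by (intro B'.r_inj) auto
  ultimately have "(\<phi>, \<sigma>) \<in> homs (zMaps_cat \<U>) Z Z'"
    by (simp add: zMaps_homs) (simp add: \<phi>_def \<sigma>_def)
  then show ?thesis using \<phi>(2) \<sigma>(2) by blast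
qed

lemma zMaps_iso_of_same_rep:
  assumes Z: "Z \<in> objs (zMaps_cat \<U>)" and Z': "Z' \<in> objs (zMaps_cat \<U>)"
    and s: "pow_rep X (calg Z) s" and s': "pow_rep X (calg Z') s'"
    and same: "(s \<circ> amap Z) ` carrier (dalg Z) = (s' \<circ> amap Z') ` carrier (dalg Z')"
  shows "\<exists>u. is_iso (zMaps_cat \<U>) Z Z' u"
proof -
  obtain \<phi> \<sigma> where u: "(\<phi>, \<sigma>) \<in> homs (zMaps_cat \<U>) Z Z'"
    "\<forall>x\<in>carrier (dalg Z). s' (amap Z' (\<phi> x)) = s (amap Z x)" "\<forall>y\<in>carrier (calg Z). s' (\<sigma> y) = s y"
    using zMaps_hom_of_same_rep[OF assms] by blast
  obtain \<psi> \<tau> where v: "(\<psi>, \<tau>) \<in> homs (zMaps_cat \<U>) Z' Z"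
    "\<forall>x\<in>carrier (dalg Z'). s (amap Z (\<psi> x)) = s' (amap Z' x)" "\<forall>y\<in>carrier (calg Z'). s (\<tau> y) = s' y"
    using zMaps_hom_of_same_rep[OF Z' Z s' s same[symmetric]] by blast
  \<comment> \<open>Stated for arbitrary \<open>W\<close> and \<open>W'\<close> so that it yields
    both composites. A round trip keeps the represented set, hence the element, by injectivity of
    the representation.\<close>
  have inv: "compn (zMaps_cat \<U>) W W' W (\<psi>', \<tau>') (\<phi>', \<sigma>') = ident (zMaps_cat \<U>) W"
    if W: "W \<in> objs (zMaps_cat \<U>)" and t: "pow_rep X (calg W) t"
      and h: "(\<phi>', \<sigma>') \<in> homs (zMaps_cat \<U>) W W'" "(\<psi>', \<tau>') \<in> homs (zMaps_cat \<U>) W' W"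
      and \<phi>': "\<forall>x\<in>carrier (dalg W). t' (amap W' (\<phi>' x)) = t (amap W x)" "\<forall>y\<in>carrier (calg W). t' (\<sigma>' y) = t y"
      and \<psi>': "\<forall>x\<in>carrier (dalg W'). t (amap W (\<psi>' x)) = t' (amap W' x)" "\<forall>y\<in>carrier (calg W'). t (\<tau>' y) = t' y"
    for W W' t t' \<phi>' \<sigma>' \<psi>' \<tau>'
  proof -
    interpret t: pow_rep X "calg W" t by fact
    have zm: "boolean_z_map (dalg W) (calg W) (amap W)" using W by (simp add: zMaps_objs)
    interpret A: set_rep X "(t \<circ> amap W) ` carrier (dalg W)" "dalg W" "t \<circ> amap W"
      by (rule boolean_z_map_rep[OF zm t])
    have in1: "\<phi>' x \<in> carrier (dalg W')" "\<psi>' (\<phi>' x) \<in> carrier (dalg W)" if "x \<in> carrier (dalg W)" for x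
      by (intro zMaps_hom_carrier(1)[OF h(1)] zMaps_hom_carrier(1)[OF h(2)] that)+
    have in2: "\<sigma>' y \<in> carrier (calg W')" "\<tau>' (\<sigma>' y) \<in> carrier (calg W)" if "y \<in> carrier (calg W)" for y
      by (intro zMaps_hom_carrier(2)[OF h(1)] zMaps_hom_carrier(2)[OF h(2)] that)+
    have "\<psi>' (\<phi>' x) = x" if "x \<in> carrier (dalg W)" for x
      using \<phi>'(1) \<psi>'(1) in1[OF that] that by (intro A.r_inj) simp_all
    moreover have "\<tau>' (\<sigma>' y) = y" if "y \<in> carrier (calg W)" for y
      using \<phi>'(2) \<psi>'(2) in2[OF that] that by (intro t.r_inj) simp_all
    ultimately show ?thesis
      by (auto simp: zMaps_compn zMaps_ident compose_def restrict_def)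
  qed
  show ?thesis
    unfolding is_iso_def
    using u(1) v(1) inv[OF Z s u(1) v(1) u(2,3) v(2,3)] inv[OF Z' s' v(1) u(1) v(2,3) u(2,3)] by blast
qed

section \<open>Essential surjectivity and the duality\<close>

context encoded_universe
begin

lemma clopen_functor_ess_surj:
  assumes Z: "Z \<in> objs (zMaps_cat \<U>)"
  shows "\<exists>K\<in>objs (ZComp_cat \<U>). \<exists>u. is_iso (zMaps_cat \<U>) (fobj clopen_functor K) Z u"
proof -
  let ?A = "dalg Z" and ?B = "calg Z"
  have sm: "carrier ?A \<in> \<U>" "carrier ?B \<in> \<U>" and zm: "boolean_z_map ?A ?B (amap Z)"
    using Z by (auto simp: zMaps_objs)
  define X where "X = {a. is_atom ?B a}"
  define r where "r b = {a. is_atom ?B a \<and> a \<sqsubseteq>\<^bsub>?B\<^esub> b}" for b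
  define \<A> where "\<A> = (r \<circ> amap Z) ` carrier ?A"
  have rep: "pow_rep X ?B r"
    using atoms_pow_rep zm unfolding X_def r_def boolean_z_map_def by blast
  interpret B: pow_rep X ?B r by (rule rep)
  interpret A: set_rep X \<A> ?A "r \<circ> amap Z"
    unfolding \<A>_def by (rule boolean_z_map_rep[OF zm rep])
  have X_sub: "X \<subseteq> carrier ?B" by (auto simp: X_def is_atom_def)
  have \<alpha>: "amap Z x \<in> carrier ?B" if "x \<in> carrier ?A" for x
    using zm that by (auto simp: boolean_z_map_def boolean_hom_def)
  \<comment> \<open>The ground set consists of the atoms themselves, so an atom belongs to its own
    set, and that set has only one point.\<close>
  have r_atom: "r p = {p}" if "p \<in> X" for p
  proof -
    have p: "is_atom ?B p" "p \<in> carrier ?B" using that X_sub by (auto simp: X_def)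
    interpret partial_order ?B by (rule B.partial_order)
    have "p \<in> r p" using p by (simp add: r_def)
    moreover obtain q where "r p = {q}" using B.atom_singleton[OF p(1)] by blast
    ultimately show ?thesis by simp
  qed
  \<comment> \<open>Here the z-map condition enters: \<open>p\<close> is a meet of elements of the
    image, so their sets intersect exactly in \<open>{p}\<close> and one of them omits
    \<open>q\<close>.\<close>
  have sep: "\<exists>U\<in>\<A>. p \<in> U \<and> q \<notin> U" if pq: "p \<in> X" "q \<in> X" "p \<noteq> q" for p q
  proof -
    obtain S where S: "S \<subseteq> amap Z ` carrier ?A" "p = \<Sqinter>\<^bsub>?B\<^esub>S"
      using zm pq(1) unfolding boolean_z_map_def X_def by blast
    then have "S \<subseteq> carrier ?B" using \<alpha> by auto
    then have meet: "X \<inter> \<Inter>(r ` S) = {p}" using B.Inf(3)[of S] r_atom[OF pq(1)] S(2) by simp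
    have "q \<notin> X \<inter> \<Inter>(r ` S)" "p \<in> X \<inter> \<Inter>(r ` S)" unfolding meet using pq(3) by simp_all
    then obtain b where b: "b \<in> S" "q \<notin> r b" "p \<in> r b" using pq(2) by blast
    then obtain x where "x \<in> carrier ?A" "b = amap Z x" using S(1) by blast
    then show ?thesis using b unfolding \<A>_def by (intro bexI[of _ "r b"]) auto
  qed
  \<comment> \<open>A point of the Stone space is a function on \<open>\<A>\<close>, and
    \<open>\<A>\<close> is a copy of \<open>carrier ?A\<close>; the point is recorded by the subset
    of \<open>carrier ?A\<close> on which it is true. One power set of a small set thus contains the
    whole space, up to coding.\<close>
  define k where "k p = e (carrier ?A) {a \<in> carrier ?A. p ((r \<circ> amap Z) a)}" for p
  have k_inj: "inj_on k (\<A> \<rightarrow>\<^sub>E UNIV)"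
  proof (rule inj_onI)
    fix p q :: "'u set \<Rightarrow> bool"
    assume p: "p \<in> \<A> \<rightarrow>\<^sub>E UNIV" and q: "q \<in> \<A> \<rightarrow>\<^sub>E UNIV" and "k p = k q"
    then have eq: "{a \<in> carrier ?A. p ((r \<circ> amap Z) a)} = {a \<in> carrier ?A. q ((r \<circ> amap Z) a)}"
      unfolding k_def by (intro inj_onD[OF inj_e[OF sm(1)]]) auto
    show "p = q"
    proof (rule PiE_ext[OF p q])
      fix U assume "U \<in> \<A>"
      then obtain a where "a \<in> carrier ?A" "U = (r \<circ> amap Z) a" unfolding \<A>_def by blast
      then have "p U \<longleftrightarrow> a \<in> {a \<in> carrier ?A. p ((r \<circ> amap Z) a)}"
        and "q U \<longleftrightarrow> a \<in> {a \<in> carrier ?A. q ((r \<circ> amap Z) a)}" by simp_all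
      then show "p U = q U" by (simp only: eq)
    qed
  qed
  obtain T Y c where K: "topspace T = X" "topspace Y \<subseteq> k ` (\<A> \<rightarrow>\<^sub>E UNIV)" "c \<in> extensional X"
    "hausdorff_compactification T Y c" "zero_dimensional_space Y" "(\<lambda>V. c -` V \<inter> X) ` clopens Y = \<A>"
    using stone_compactification[OF A.algebra_axioms sep k_inj] by blast
  have X_small: "X \<in> \<U>" by (rule subset_closed[OF sm(2) X_sub])
  have "k ` (\<A> \<rightarrow>\<^sub>E UNIV) \<subseteq> e (carrier ?A) ` Pow (carrier ?A)" by (auto simp: k_def)
  then have Y_small: "topspace Y \<in> \<U>"
    using K(2) by (intro subset_closed[OF e_small[OF sm(1)]]) blast
  let ?K = "\<lparr>src = T, tgt = Y, cmap = c\<rparr>"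
  have obj: "?K \<in> objs (ZComp_cat \<U>)"
    using K X_small Y_small by (simp add: ZComp_objs)
  \<comment> \<open>On the side of the new compactification the represented field consists of the
    traces of clopen sets, which is \<open>\<A>\<close> by construction; hence it agrees with that
    of \<open>Z\<close>.\<close>
  have "(dec X \<circ> preim X (topspace Y) (clopens Y) c) ` (e (topspace Y) ` clopens Y) =
      (\<lambda>V. c -` V \<inter> X) ` clopens Y"
    unfolding image_image
  proof (rule image_cong[OF refl])
    fix V assume V: "V \<in> clopens Y"
    then show "(dec X \<circ> preim X (topspace Y) (clopens Y) c) (e (topspace Y) V) = c -` V \<inter> X"
      using dec_preim[OF X_small, of "e (topspace Y) V" "topspace Y" "clopens Y" c]
        dec_e[OF Y_small clopens_subset[OF V]] by simp
  qed
  then have "(dec X \<circ> amap (fobj clopen_functor ?K)) ` carrier (dalg (fobj clopen_functor ?K)) =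
      (r \<circ> amap Z) ` carrier ?A"
    using K(1,6) by (simp add: clopen_functor_def carrier_set_alg \<A>_def)
  moreover have "pow_rep X (calg (fobj clopen_functor ?K)) (dec X)"
    using set_alg_pow_rep[OF X_small] K(1) by (simp add: clopen_functor_def)
  ultimately have "\<exists>u. is_iso (zMaps_cat \<U>) (fobj clopen_functor ?K) Z u"
    by (intro zMaps_iso_of_same_rep[OF clopen_functor_obj[OF obj] Z _ rep])
  then show ?thesis using obj by blast
qed

lemma ZComp_zMaps_dually_equivalent: "dually_equivalent (ZComp_cat \<U>) (zMaps_cat \<U>)"
proof (rule dually_equivalent_if_fully_faithful[OF category_ZComp category_zMaps contravariant_clopen_functor])
  fix K K' assume K: "K \<in> objs (ZComp_cat \<U>)" "K' \<in> objs (ZComp_cat \<U>)"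
  show "bij_betw (fmap clopen_functor K K') (homs (ZComp_cat \<U>) K K')
      (homs (zMaps_cat \<U>) (fobj clopen_functor K') (fobj clopen_functor K))"
    unfolding bij_betw_def
  proof (intro conjI equalityI subsetI clopen_functor_faithful[OF K])
    fix u assume "u \<in> homs (zMaps_cat \<U>) (fobj clopen_functor K') (fobj clopen_functor K)"
    then show "u \<in> fmap clopen_functor K K' ` homs (ZComp_cat \<U>) K K'"
      using clopen_functor_full[OF K] by blast
  qed (use clopen_functor_map[OF K] in blast)
qed (rule clopen_functor_ess_surj)

end

theorem theorem8p8:
  fixes \<U> :: "'u set set"
  assumes "universe \<U>"
  shows "dually_equivalent (ZComp_cat \<U>) (zMaps_cat \<U>)"
proof -
  \<comment> \<open>The universe only bounds \<open>Pow S\<close> by a small set up to injection;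
    the image of such an injection is itself small, and choosing one for each \<open>S\<close> gives
    the coding \<open>e\<close>.\<close>
  have "\<forall>S\<in>\<U>. \<exists>h. inj_on h (Pow S) \<and> h ` Pow S \<in> \<U>"
  proof
    fix S assume S: "S \<in> \<U>"
    obtain T where T: "T \<in> \<U>" "Pow S \<lesssim> T" using assms S unfolding universe_def by blast
    then obtain h where h: "inj_on h (Pow S)" "h ` Pow S \<subseteq> T" unfolding lepoll_def by blast
    from h(2) have "h ` Pow S \<lesssim> T" by (rule subset_imp_lepoll)
    then have "h ` Pow S \<in> \<U>" using T(1) assms unfolding universe_def by blast
    then show "\<exists>h. inj_on h (Pow S) \<and> h ` Pow S \<in> \<U>" using h(1) by blast
  qed
  from bchoice[OF this] obtain e where "\<forall>S\<in>\<U>. inj_on (e S) (Pow S) \<and> e S ` Pow S \<in> \<U>" by blast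
  then interpret encoded_universe \<U> e
    using assms by unfold_locales (auto simp: universe_def)
  show ?thesis by (rule ZComp_zMaps_dually_equivalent)
qed

end
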